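(* Let $G=\langle A\rangle$ be a group with finite generating set $A$, let $H=\langle B\rangle\leq G$ be a subgroup of finite index with finite generating set $B$, and let $\pi_1:\tilde A^*\to G$ and $\pi_2:\tilde B^*\to H$ be the canonical surjective homomorphisms. Then the following decision problems are recursively equivalent: (i) taking as input a context-free grammar which generates a language $L\subseteq\tilde A^*$, with $K=\pi_1(L)\subseteq G$, decide whether or not $K\in\mathrm{CF}(G)$, i.e. whether $K\pi_1^{-1}\subseteq\tilde A^*$ is a context-free language; (ii) taking as input a context-free grammar which generates a language $L\subseteq\tilde B^*$, with $K=\pi_2(L)\subseteq H$, decide whether or not $K\in\mathrm{CF}(H)$, i.e. whether $K\pi_2^{-1}\subseteq\tilde B^*$ is a context-free language.
   Context: For a finite set $A$, $\tilde A=A\cup A^{-1}$ (formal inverses). For a group $G$ with finite generating set $A$ and canonical homomorphism $\pi:\tilde A^*\to G$, a subset $K\subseteq G$ is context-free if its full preimage $K\pi^{-1}$ is a context-free language, and $\mathrm{CF}(G)$ denotes the class of context-free subsets. Two decision problems are recursively equivalent if each is algorithmically (Turing) reducible to the other: given an algorithm (oracle) solving either one, one can algorithmically solve the other. *)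

theory Defs
  imports "HOL-Algebra.Generated_Groups" "HOL-Library.Nat_Bijection"
begin

section \<open>Context-free grammars\<close>

datatype ('n, 't) sym = NT 'n | Tm 't

text \<open>
  A grammar is a start symbol together with a finite list of productions. The finite set of
  nonterminals is implicit: it consists of the nonterminals that occur in the grammar.
\<close>

datatype ('n, 't) cfg = CFG (start: 'n) (prods: "('n \<times> ('n, 't) sym list) list")

inductive derives1 :: "('n, 't) cfg \<Rightarrow> ('n, 't) sym list \<Rightarrow> ('n, 't) sym list \<Rightarrow> bool"
  for g where
  "(X, w) \<in> set (prods g) \<Longrightarrow> derives1 g (u @ [NT X] @ v) (u @ w @ v)"

definition lang :: "('n, 't) cfg \<Rightarrow> 't list set" where
  "lang g = {w. (derives1 g)\<^sup>*\<^sup>* [NT (start g)] (map Tm w)}"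

definition cfg_over :: "'t set \<Rightarrow> ('n, 't) cfg \<Rightarrow> bool" where
  "cfg_over \<Sigma> g \<longleftrightarrow> (\<forall>(X, w) \<in> set (prods g). \<forall>a. Tm a \<in> set w \<longrightarrow> a \<in> \<Sigma>)"

text \<open>
  Only finitely many nonterminals occur in a grammar, so it is no restriction to take them to be
  natural numbers.
\<close>

definition context_free :: "'t set \<Rightarrow> 't list set \<Rightarrow> bool" where
  "context_free \<Sigma> L \<longleftrightarrow> (\<exists>g :: (nat, 't) cfg. cfg_over \<Sigma> g \<and> L = lang g)"


section \<open>Words over a generating set and context-free subsets of a group\<close>

text \<open>
  The inverse letters are formal: \<open>Pos a\<close> and \<open>Neg a\<close> are always distinct, and \<open>Neg a\<close> is distinct
  from \<open>Pos b\<close> even when \<open>b\<close> is the inverse of \<open>a\<close> in the group.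
\<close>

datatype 'a letter = Pos 'a | Neg 'a

definition tilde :: "'a set \<Rightarrow> 'a letter set" where
  "tilde A = Pos ` A \<union> Neg ` A"

fun letter_val :: "('a, 'm) monoid_scheme \<Rightarrow> 'a letter \<Rightarrow> 'a" where
  "letter_val G (Pos a) = a"
| "letter_val G (Neg a) = inv\<^bsub>G\<^esub> a"

fun word_val :: "('a, 'm) monoid_scheme \<Rightarrow> 'a letter list \<Rightarrow> 'a" where
  "word_val G [] = \<one>\<^bsub>G\<^esub>"
| "word_val G (x # w) = letter_val G x \<otimes>\<^bsub>G\<^esub> word_val G w"

definition full_preimage ::
    "('a, 'm) monoid_scheme \<Rightarrow> 'a set \<Rightarrow> 'a set \<Rightarrow> 'a letter list set" where
  "full_preimage G A K = {w \<in> lists (tilde A). word_val G w \<in> K}"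

definition CF :: "('a, 'm) monoid_scheme \<Rightarrow> 'a set \<Rightarrow> 'a set set" where
  "CF G A = {K. K \<subseteq> carrier G \<and> context_free (tilde A) (full_preimage G A K)}"


section \<open>Relative computability\<close>

text \<open>
  Programs for the partial recursive functions (of several natural number arguments), with an
  additional instruction \<open>Query\<close> that asks whether its argument belongs to a given set \<open>X\<close>.
\<close>

datatype prog =
    Zero | Succ | Proj nat | Query
  | Comp prog "prog list" | PrimRec prog prog | Mu prog

inductive computes :: "nat set \<Rightarrow> prog \<Rightarrow> nat list \<Rightarrow> nat \<Rightarrow> bool" for X where
  "computes X Zero xs 0"
| "computes X Succ [x] (Suc x)"
| "i < length xs \<Longrightarrow> computes X (Proj i) xs (xs ! i)"
| "computes X Query [x] (if x \<in> X then 1 else 0)"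
| "list_all2 (\<lambda>q y. computes X q xs y) qs ys \<Longrightarrow> computes X p ys z
    \<Longrightarrow> computes X (Comp p qs) xs z"
| "computes X p xs y \<Longrightarrow> computes X (PrimRec p q) (0 # xs) y"
| "computes X (PrimRec p q) (k # xs) r \<Longrightarrow> computes X q (k # r # xs) y
    \<Longrightarrow> computes X (PrimRec p q) (Suc k # xs) y"
| "computes X p (y # xs) 0 \<Longrightarrow> (\<And>z. z < y \<Longrightarrow> \<exists>v. computes X p (z # xs) (Suc v))
    \<Longrightarrow> computes X (Mu p) xs y"

definition turing_reducible :: "nat set \<Rightarrow> nat set \<Rightarrow> bool" (infix "\<le>\<^sub>T" 50) where
  "P \<le>\<^sub>T Q \<longleftrightarrow> (\<exists>p. \<forall>n. computes Q p [n] (if n \<in> P then 1 else 0))"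

definition recursively_equivalent :: "nat set \<Rightarrow> nat set \<Rightarrow> bool" where
  "recursively_equivalent P Q \<longleftrightarrow> P \<le>\<^sub>T Q \<and> Q \<le>\<^sub>T P"


section \<open>Grammars as inputs, and the decision problem\<close>

text \<open>
  A grammar is presented to an algorithm as a natural number, given a numbering \<open>\<nu>\<close> of the letters
  of its terminal alphabet.
\<close>

fun sym_code :: "('t \<Rightarrow> nat) \<Rightarrow> (nat, 't) sym \<Rightarrow> nat" where
  "sym_code \<nu> (NT X) = sum_encode (Inl X)"
| "sym_code \<nu> (Tm a) = sum_encode (Inr (\<nu> a))"

fun prod_code :: "('t \<Rightarrow> nat) \<Rightarrow> nat \<times> (nat, 't) sym list \<Rightarrow> nat" where
  "prod_code \<nu> (X, w) = prod_encode (X, list_encode (map (sym_code \<nu>) w))"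

definition cfg_code :: "('t \<Rightarrow> nat) \<Rightarrow> (nat, 't) cfg \<Rightarrow> nat" where
  "cfg_code \<nu> g = prod_encode (start g, list_encode (map (prod_code \<nu>) (prods g)))"

lemma inj_on_cfg_code:
  assumes "inj_on \<nu> \<Sigma>"
  shows "inj_on (cfg_code \<nu>) {g. cfg_over \<Sigma> g}"
proof (rule inj_onI)
  have sym: "s = t"
    if "sym_code \<nu> s = sym_code \<nu> t"
      and "\<And>a. s = Tm a \<Longrightarrow> a \<in> \<Sigma>" and "\<And>a. t = Tm a \<Longrightarrow> a \<in> \<Sigma>" for s t
    using that assms by (cases s; cases t) (auto simp: sum_encode_eq dest: inj_onD)
  have w: "u = v"
    if "map (sym_code \<nu>) u = map (sym_code \<nu>) v"
      and "\<And>a. Tm a \<in> set u \<Longrightarrow> a \<in> \<Sigma>" and "\<And>a. Tm a \<in> set v \<Longrightarrow> a \<in> \<Sigma>" for u v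
  proof (rule map_inj_on[OF that(1)], rule inj_onI)
    fix s t assume "s \<in> set u \<union> set v" "t \<in> set u \<union> set v" "sym_code \<nu> s = sym_code \<nu> t"
    then show "s = t" using that(2,3) by (intro sym) auto
  qed
  fix g h :: "(nat, 'a) cfg"
  assume "g \<in> {g. cfg_over \<Sigma> g}" "h \<in> {g. cfg_over \<Sigma> g}"
    and eq: "cfg_code \<nu> g = cfg_code \<nu> h"
  then have over: "cfg_over \<Sigma> g" "cfg_over \<Sigma> h" by auto
  have "inj_on (prod_code \<nu>) (set (prods g) \<union> set (prods h))"
  proof (rule inj_onI)
    fix p q
    assume p: "p \<in> set (prods g) \<union> set (prods h)" and q: "q \<in> set (prods g) \<union> set (prods h)"
      and pq: "prod_code \<nu> p = prod_code \<nu> q"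
    obtain X u where pX: "p = (X, u)" by (cases p)
    obtain Y v where qY: "q = (Y, v)" by (cases q)
    have XY: "X = Y" and uv: "map (sym_code \<nu>) u = map (sym_code \<nu>) v"
      using pq by (simp_all add: pX qY prod_encode_eq list_encode_eq)
    have "a \<in> \<Sigma>" if "Tm a \<in> set u" for a
      using p over that unfolding pX cfg_over_def by blast
    moreover have "a \<in> \<Sigma>" if "Tm a \<in> set v" for a
      using q over that unfolding qY cfg_over_def by blast
    ultimately show "p = q" using w[OF uv] XY by (simp add: pX qY)
  qed
  then have "prods g = prods h"
    using eq map_inj_on by (simp add: cfg_code_def prod_encode_eq list_encode_eq) blast
  then show "g = h"
    using eq by (cases g; cases h) (simp add: cfg_code_def prod_encode_eq)
qed

text \<open>
  The decision problem is represented by the set of codes of its positive instances; the instances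
  are all grammars with terminal alphabet \<open>tilde A\<close>. Numbers that do not code an instance count as
  negative.
\<close>

definition CF_problem ::
    "('a letter \<Rightarrow> nat) \<Rightarrow> ('a, 'm) monoid_scheme \<Rightarrow> 'a set \<Rightarrow> nat set" where
  "CF_problem \<nu> G A =
     {cfg_code \<nu> g | g. cfg_over (tilde A) g \<and> word_val G ` lang g \<in> CF G A}"

end

(*
A word over A whose value lies in the coset H r is rewritten, by the finite Reidemeister-Schreier
machine on the cosets of H, into a word over B for the value times r^-1. Writing K_r for the set of
h in H with h r in K, the full preimage of K is the union over the cosets of inverse images, under
this machine, of the full preimages of the K_r; conversely the full preimage of K_r is the inverse
image of that of K under the map that substitutes words over A for the letters of B and appends a
word for r. As context-free languages are closed under finite-state transductions, K is in CF(G) if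
and only if all K_r are in CF(H).

If K is the value set of a context-free language, then K_r is that of its image under the machine
stopped in H r. A grammar of the image is obtained by the triple construction, which is carried out
here on codes of grammars, so that problem (i) reduces to finitely many queries to problem (ii). For
the converse reduction, the substitution of words over A for the letters of B does not change K, and
K_r is empty for r outside H.
*)

theory Submission
  imports Defs
begin

text \<open>One grammar construction is used twice: \<open>trans_rules\<close> gives closure under
  transductions, which is all that the equivalences about groups require, and its repetition on
  numbers gives the oracle programs. The reductions transform a grammar of L, never one of the full
  preimage of K, which need not exist. This is sound because the coset reached by the machine and
  the value of the rewritten word depend only on the value of the word read. A reduction has to
  answer on every number, so it tests first whether its input codes an instance. The new grammar is
  assembled by arithmetic: a nonterminal is the coded triple of a state, a suffix of a right-hand
  side and a state, which avoids a table of fresh names. The order and repetition of rules do not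
  affect the language, so the program may list them as is convenient.\<close>

section \<open>Derivations in context-free grammars\<close>

text \<open>A big-step form of derivations: inductions follow the derivation tree instead of a
  sequence of rewritings. The rules form a set of any nonterminal type, so that constructions can be
  stated before a numbering is chosen.\<close>

inductive yields :: "('n \<times> ('n, 't) sym list) set \<Rightarrow> ('n, 't) sym list \<Rightarrow> 't list \<Rightarrow> bool"
  for R where
  yields_Nil: "yields R [] []"
| yields_Tm: "yields R s w \<Longrightarrow> yields R (Tm a # s) (a # w)"
| yields_NT: "(X, r) \<in> R \<Longrightarrow> yields R r u \<Longrightarrow> yields R s v \<Longrightarrow> yields R (NT X # s) (u @ v)"

inductive_cases yields_NilE: "yields R [] w"
inductive_cases yields_TmE: "yields R (Tm a # s) w"
inductive_cases yields_NTE: "yields R (NT X # s) w"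

lemma yields_append:
  "yields R s w \<Longrightarrow> yields R s' w' \<Longrightarrow> yields R (s @ s') (w @ w')"
  by (induction rule: yields.induct) (auto intro: yields.intros)

text \<open>This is what makes derivations context-free: the parts of a sentential form derive
  independently of each other.\<close>

lemma yields_appendE:
  assumes "yields R (s @ s') w"
  obtains u v where "w = u @ v" "yields R s u" "yields R s' v"
  using assms
proof (induction s arbitrary: w thesis)
  case Nil
  then show ?case using yields_Nil by fastforce
next
  case (Cons x s)
  show ?case
  proof (cases x)
    case (NT X)
    then obtain r u v where r: "(X, r) \<in> R" "yields R r u" "yields R (s @ s') v" "w = u @ v"
      using Cons.prems(2) by (auto elim: yields_NTE)
    from Cons.IH[OF _ r(3)] obtain v1 v2 where "v = v1 @ v2" "yields R s v1" "yields R s' v2"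
      by blast
    then show ?thesis using Cons.prems(1)[of "u @ v1" v2] r NT by (auto intro: yields_NT)
  next
    case (Tm a)
    then obtain v where r: "yields R (s @ s') v" "w = a # v"
      using Cons.prems(2) by (auto elim: yields_TmE)
    from Cons.IH[OF _ r(1)] obtain v1 v2 where "v = v1 @ v2" "yields R s v1" "yields R s' v2"
      by blast
    then show ?thesis using Cons.prems(1)[of "a # v1" v2] r Tm by (auto intro: yields_Tm)
  qed
qed

lemma yields_map_Tm: "yields R (map Tm w) w"
  by (induction w) (auto intro: yields.intros)

lemma yields_rule: "(X, r) \<in> R \<Longrightarrow> yields R r w \<Longrightarrow> yields R [NT X] w"
  using yields_NT[of X r R w "[]" "[]"] yields_Nil by auto

lemma yields_singleE:
  assumes "yields R [NT X] w"
  obtains r where "(X, r) \<in> R" "yields R r w"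
  using assms by (auto elim!: yields_NTE yields_NilE)

lemma derives1_context:
  "(derives1 g)\<^sup>*\<^sup>* s s' \<Longrightarrow> (derives1 g)\<^sup>*\<^sup>* (u @ s @ v) (u @ s' @ v)"
proof (induction rule: rtranclp_induct)
  case (step y z)
  from step(2) have "derives1 g (u @ y @ v) (u @ z @ v)"
  proof cases
    case (1 X w u' v')
    then show ?thesis using derives1.intros[of X w g "u @ u'" "v' @ v"] by simp
  qed
  with step(3) show ?case by (rule rtranclp.rtrancl_into_rtrancl)
qed simp

lemma yields_imp_derives:
  "yields (set (prods g)) s w \<Longrightarrow> (derives1 g)\<^sup>*\<^sup>* s (map Tm w)"
proof (induction rule: yields.induct)
  case (yields_Tm s w a)
  show ?case using derives1_context[OF yields_Tm(2), of "[Tm a]" "[]"] by simp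
next
  case (yields_NT X r u s v)
  have "derives1 g ([] @ [NT X] @ s) ([] @ r @ s)"
    by (rule derives1.intros) (rule yields_NT(1))
  moreover have "(derives1 g)\<^sup>*\<^sup>* (r @ s) (map Tm u @ s)"
    using derives1_context[OF yields_NT(4), of "[]" s] by simp
  moreover have "(derives1 g)\<^sup>*\<^sup>* (map Tm u @ s) (map Tm u @ map Tm v)"
    using derives1_context[OF yields_NT(5), of "map Tm u" "[]"] by simp
  ultimately show ?case by simp
qed simp

text \<open>The induction peels off the first rewriting step, whose place in the sentential form is
  isolated by \<open>yields_appendE\<close>.\<close>

lemma derives_imp_yields:
  "(derives1 g)\<^sup>*\<^sup>* s s' \<Longrightarrow> yields (set (prods g)) s' w \<Longrightarrow> yields (set (prods g)) s w"
proof (induction rule: converse_rtranclp_induct)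
  case (step y z)
  from step(3)[OF step(4)] have z: "yields (set (prods g)) z w" .
  from step(1) show ?case
  proof cases
    case (1 X r u v)
    from z obtain w1 w2 w3 where "w = w1 @ w2 @ w3" "yields (set (prods g)) u w1"
      "yields (set (prods g)) r w2" "yields (set (prods g)) v w3"
      unfolding 1 by (metis yields_appendE)
    then show ?thesis unfolding 1 by (auto intro!: yields_append intro: yields_NT 1(3))
  qed
qed simp

lemma lang_eq_yields: "lang g = {w. yields (set (prods g)) [NT (start g)] w}"
  unfolding lang_def using yields_imp_derives derives_imp_yields yields_map_Tm by blast

text \<open>
  To bound the language of a grammar from above it suffices to give, for each nonterminal, a
  property of words that is compatible with every rule.
\<close>

fun matches :: "('n \<Rightarrow> 't list \<Rightarrow> bool) \<Rightarrow> ('n, 't) sym list \<Rightarrow> 't list \<Rightarrow> bool" where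
  "matches P [] u \<longleftrightarrow> u = []"
| "matches P (Tm a # s) u \<longleftrightarrow> (\<exists>v. u = a # v \<and> matches P s v)"
| "matches P (NT X # s) u \<longleftrightarrow> (\<exists>v w. u = v @ w \<and> P X v \<and> matches P s w)"

lemma matches_map_Tm_append:
  "matches P (map Tm v @ s) u \<longleftrightarrow> (\<exists>w. u = v @ w \<and> matches P s w)"
  by (induction v arbitrary: u) auto

lemma yields_matches:
  assumes "yields R s u" and "\<And>X r u. (X, r) \<in> R \<Longrightarrow> matches P r u \<Longrightarrow> P X u"
  shows "matches P s u"
  using assms(1) by induction (auto dest: assms(2))

definition rules_over :: "'t set \<Rightarrow> ('n \<times> ('n, 't) sym list) set \<Rightarrow> bool" where
  "rules_over \<Sigma> R \<longleftrightarrow> (\<forall>x\<in>R. \<forall>a. Tm a \<in> set (snd x) \<longrightarrow> a \<in> \<Sigma>)"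

lemma cfg_over_iff: "cfg_over \<Sigma> g \<longleftrightarrow> rules_over \<Sigma> (set (prods g))"
  unfolding cfg_over_def rules_over_def by (simp add: split_beta)

lemma yields_over:
  "yields R s w \<Longrightarrow> rules_over \<Sigma> R \<Longrightarrow> (\<And>a. Tm a \<in> set s \<Longrightarrow> a \<in> \<Sigma>) \<Longrightarrow> w \<in> lists \<Sigma>"
proof (induction rule: yields.induct)
  case (yields_NT X r u s v)
  then show ?case unfolding rules_over_def by (fastforce simp: in_lists_conv_set)
qed auto

lemma lang_over: "cfg_over \<Sigma> g \<Longrightarrow> lang g \<subseteq> lists \<Sigma>"
  unfolding lang_eq_yields cfg_over_iff using yields_over by fastforce

section \<open>Change of nonterminals and finite unions of context-free languages\<close>

definition rename :: "('n \<Rightarrow> 'm) \<Rightarrow> 'n \<times> ('n, 't) sym list \<Rightarrow> 'm \<times> ('m, 't) sym list" where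
  "rename f = (\<lambda>(X, r). (f X, map (map_sym f (\<lambda>a. a)) r))"

lemma rename_simp [simp]: "rename f (X, r) = (f X, map (map_sym f (\<lambda>a. a)) r)"
  by (simp add: rename_def)

definition nonterms :: "('n \<times> ('n, 't) sym list) set \<Rightarrow> 'n set" where
  "nonterms R = (\<Union>(X, r)\<in>R. insert X {Y. NT Y \<in> set r})"

lemma nonterms_intro:
  "(X, r) \<in> R \<Longrightarrow> X \<in> nonterms R" "(X, r) \<in> R \<Longrightarrow> NT Y \<in> set r \<Longrightarrow> Y \<in> nonterms R"
  unfolding nonterms_def by auto

lemma finite_nonterms: "finite R \<Longrightarrow> finite (nonterms R)"
proof -
  have "finite {Y. NT Y \<in> set r}" for r :: "('n, 't) sym list"
    by (rule finite_surj[of "set r" _ "\<lambda>s. case s of NT Y \<Rightarrow> Y | Tm a \<Rightarrow> undefined"])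
      (auto simp: image_iff intro!: bexI split: sym.splits)
  then show "finite R \<Longrightarrow> finite (nonterms R)" unfolding nonterms_def by auto
qed

lemma yields_rename:
  "yields R s w \<Longrightarrow> yields (rename f ` R) (map (map_sym f (\<lambda>a. a)) s) w"
proof (induction rule: yields.induct)
  case (yields_NT X r u s v)
  then have "(f X, map (map_sym f (\<lambda>a. a)) r) \<in> rename f ` R"
    by force
  then show ?case using yields_NT yields.yields_NT[of "f X"] by simp
qed (auto intro: yields.intros)

text \<open>Injectivity on the nonterminals that occur is enough: renaming back by
  \<open>inv_into N f\<close> restores every rule, so the converse is \<open>yields_rename\<close>
  once more.\<close>

lemma yields_rename_iff:
  assumes "inj_on f N" "S \<in> N" "nonterms R \<subseteq> N"
  shows "yields (rename f ` R) [NT (f S)] w \<longleftrightarrow> yields R [NT S] w"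
proof
  assume "yields R [NT S] w"
  then show "yields (rename f ` R) [NT (f S)] w" using yields_rename by fastforce
next
  assume y: "yields (rename f ` R) [NT (f S)] w"
  let ?g = "inv_into N f"
  have "rename ?g (rename f x) = x" if "x \<in> R" for x
  proof -
    obtain X r where x: "x = (X, r)" by (cases x)
    have "map_sym ?g (\<lambda>a. a) (map_sym f (\<lambda>a. a) s) = s" if "s \<in> set r" for s
      proof (cases s)
      case (NT Y)
      then have "Y \<in> N" using nonterms_intro(2)[of X r R Y] \<open>x \<in> R\<close> \<open>s \<in> set r\<close> assms(3) x by auto
      then show ?thesis using NT assms(1) by simp
    qed simp
    then have "map (map_sym ?g (\<lambda>a. a) \<circ> map_sym f (\<lambda>a. a)) r = r" by (auto intro: map_idI)
    moreover have "X \<in> N" using that nonterms_intro(1)[of X r R] assms x by auto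
    ultimately show ?thesis using x assms by (simp add: inv_into_f_f)
  qed
  then have "rename ?g ` rename f ` R = R" by force
  then show "yields R [NT S] w" using yields_rename[OF y, of ?g] assms by (simp add: inv_into_f_f)
qed

lemma Tm_in_map_sym_image: "Tm a \<in> map_sym f (\<lambda>a. a) ` S \<longleftrightarrow> Tm a \<in> S"
proof
  assume "Tm a \<in> map_sym f (\<lambda>a. a) ` S"
  then obtain s where "s \<in> S" "Tm a = map_sym f (\<lambda>a. a) s" by blast
  then show "Tm a \<in> S" by (cases s) auto
next
  assume "Tm a \<in> S"
  then have "map_sym f (\<lambda>a. a) (Tm a) \<in> map_sym f (\<lambda>a. a) ` S" by (rule imageI)
  then show "Tm a \<in> map_sym f (\<lambda>a. a) ` S" by simp
qed

lemma rules_over_rename: "rules_over \<Sigma> (rename f ` R) \<longleftrightarrow> rules_over \<Sigma> R"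
  unfolding rules_over_def by (simp add: rename_def split_beta Tm_in_map_sym_image)

text \<open>Allows nonterminals of any type in later constructions (tagged names, triples); the
  finitely many that occur are numbered here once and for all.\<close>

lemma context_freeI:
  assumes "finite R" "rules_over \<Sigma> R"
  shows "context_free \<Sigma> {w. yields R [NT S] w}"
proof -
  let ?N = "insert S (nonterms R)"
  obtain f :: "_ \<Rightarrow> nat" where f: "inj_on f ?N"
    using finite_imp_inj_to_nat_seg[of ?N] finite_nonterms[OF assms(1)] by auto
  obtain ps where ps: "set ps = rename f ` R" using assms(1) finite_list by (metis finite_imageI)
  let ?g = "CFG (f S) ps"
  have "cfg_over \<Sigma> ?g" using assms(2) by (simp add: cfg_over_iff ps rules_over_rename)
  moreover have "{w. yields R [NT S] w} = lang ?g"
    using yields_rename_iff[OF f, of S R] by (simp add: lang_eq_yields ps subset_insertI)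
  ultimately show ?thesis unfolding context_free_def by blast
qed

lemma context_freeE:
  assumes "context_free \<Sigma> L"
  obtains R :: "(nat \<times> (nat, 't) sym list) set" and S
  where "finite R" "rules_over \<Sigma> R" "L = {w. yields R [NT S] w}"
  using assms unfolding context_free_def lang_eq_yields cfg_over_iff by blast

text \<open>The nonterminals of the \<open>i\<close>-th grammar are tagged with \<open>i\<close> to
  keep the grammars apart, and \<open>None\<close> is a fresh start symbol. An empty index set gives
  the empty language.\<close>

lemma context_free_UN:
  assumes I: "finite I" and L: "\<And>i. i \<in> I \<Longrightarrow> context_free \<Sigma> (L i)"
  shows "context_free \<Sigma> (\<Union>i\<in>I. L i)"
proof -
  have "\<forall>i\<in>I. \<exists>R S. finite R \<and> rules_over \<Sigma> R \<and> L i = {w. yields R [NT (S :: nat)] w}"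
    using context_freeE[OF L] by metis
  then obtain R S where R: "\<And>i. i \<in> I \<Longrightarrow> finite (R i)" "\<And>i. i \<in> I \<Longrightarrow> rules_over \<Sigma> (R i)"
    "\<And>i. i \<in> I \<Longrightarrow> L i = {w. yields (R i) [NT (S i :: nat)] w}" by metis
  let ?f = "\<lambda>i X. Some (i, X)"
  define T where "T = (\<Union>i\<in>I. insert (None, [NT (?f i (S i))]) (rename (?f i) ` R i))"
  have "finite T" using I R unfolding T_def by auto
  moreover have "rules_over \<Sigma> T"
  proof -
    have "rules_over \<Sigma> (rename (?f i) ` R i)" if "i \<in> I" for i
      using R(2)[OF that] by (simp add: rules_over_rename)
    then show ?thesis unfolding T_def rules_over_def by auto
  qed
  moreover have "(\<Union>i\<in>I. L i) = {w. yields T [NT None] w}"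
  proof (rule subset_antisym; rule subsetI)
    fix w assume "w \<in> (\<Union>i\<in>I. L i)"
    then obtain i where i: "i \<in> I" "yields (R i) [NT (S i)] w" using R(3) by blast
    have mono: "yields A s w \<Longrightarrow> A \<subseteq> B \<Longrightarrow> yields B s w" for A B s w
      by (induction rule: yields.induct) (auto intro: yields.intros)
    have "yields T [NT (?f i (S i))] w"
      using mono[OF yields_rename[OF i(2), of "?f i"], of T] i(1) unfolding T_def by auto
    then show "w \<in> {w. yields T [NT None] w}"
      using i(1) by (auto intro!: yields_rule[of None "[NT (?f i (S i))]"] simp: T_def)
  next
    fix w assume "w \<in> {w. yields T [NT None] w}"
    then have w: "yields T [NT None] w" by simp
    define P where "P = (\<lambda>X u. case X of None \<Rightarrow> (\<exists>i\<in>I. yields (R i) [NT (S i)] u)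
      | Some (i, X) \<Rightarrow> yields (R i) [NT X] u)"
    \<comment> \<open>A right-hand side tagged with \<open>i\<close> mentions only nonterminals
      tagged with \<open>i\<close>, so the tags never mix grammars inside a derivation.\<close>
    have m: "yields (R i) r u" if "matches P (map (map_sym (?f i) (\<lambda>a. a)) r) u" for i r u
      using that
    proof (induction r arbitrary: u)
      case Nil then show ?case by (auto intro: yields.intros)
    next
      case (Cons s r)
      show ?case
      proof (cases s)
        case (NT X)
        then obtain v w where "u = v @ w" "yields (R i) [NT X] v" "yields (R i) r w"
          using Cons by (auto simp: P_def)
        then show ?thesis using yields_append NT by fastforce
      next
        case (Tm a) then show ?thesis using Cons by (auto intro: yields.intros)
      qed
    qed
    have "matches P [NT None] w"
      using w
    proof (rule yields_matches)
      fix X r u assume "(X, r) \<in> T" "matches P r u"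
      then consider i where "i \<in> I" "X = None" "r = [NT (?f i (S i))]"
        | i Y s where "i \<in> I" "(Y, s) \<in> R i" "X = ?f i Y" "r = map (map_sym (?f i) (\<lambda>a. a)) s"
        unfolding T_def by auto
      then show "P X u"
      proof cases
        case 1 then show ?thesis using \<open>matches P r u\<close> by (auto simp: P_def)
      next
        case 2 then show ?thesis using m[of i s u] \<open>matches P r u\<close> by (auto simp: P_def intro: yields_rule)
      qed
    qed
    then show "w \<in> (\<Union>i\<in>I. L i)" using R(3) by (auto simp: P_def)
  qed
  ultimately show ?thesis using context_freeI by metis
qed

section \<open>Finite-state transductions\<close>

text \<open>An edge with \<open>None\<close> reads nothing. The inverse of a machine depends on such
  edges, as it guesses a letter before it reads the output of that letter.\<close>

inductive path :: "('q \<times> 'x option \<times> 'y list \<times> 'q) set \<Rightarrow> 'q \<Rightarrow> 'x list \<Rightarrow> 'y list \<Rightarrow> 'q \<Rightarrow> bool"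
  for E where
  path_refl: "path E p [] [] p"
| path_Some: "(p, Some a, v, r) \<in> E \<Longrightarrow> path E r w u q \<Longrightarrow> path E p (a # w) (v @ u) q"
| path_None: "(p, None, v, r) \<in> E \<Longrightarrow> path E r w u q \<Longrightarrow> path E p w (v @ u) q"

lemma path_append:
  "path E p w u r \<Longrightarrow> path E r w' u' q \<Longrightarrow> path E p (w @ w') (u @ u') q"
  by (induction rule: path.induct) (auto intro: path.intros)

lemma path_appendE:
  assumes "path E p (w @ w') u q"
  obtains r u1 u2 where "u = u1 @ u2" "path E p w u1 r" "path E r w' u2 q"
proof -
  have "path E p x u q \<Longrightarrow> x = w @ w' \<Longrightarrow>
    \<exists>r u1 u2. u = u1 @ u2 \<and> path E p w u1 r \<and> path E r w' u2 q" for x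
  proof (induction arbitrary: w rule: path.induct)
    case (path_refl p)
    then show ?case using path.path_refl by fastforce
  next
    case (path_Some p a v r x u q)
    show ?case
    proof (cases w)
      case Nil
      then have "path E p w' (v @ u) q" "path E p w [] p"
        using path_Some.hyps path_Some.prems path.path_Some[of p a v r E x u q]
        by (auto intro: path.intros)
      then show ?thesis by force
    next
      case (Cons b y)
      then have "x = y @ w'" "b = a" using path_Some.prems by auto
      then obtain s u1 u2 where "u = u1 @ u2" "path E r y u1 s" "path E s w' u2 q"
        using path_Some.IH by blast
      then have "v @ u = (v @ u1) @ u2" "path E p w (v @ u1) s" "path E s w' u2 q"
        using path_Some.hyps Cons \<open>b = a\<close> by (auto intro: path.intros)
      then show ?thesis by blast
    qed
  next
    case (path_None p v r x u q)
    then obtain s u1 u2 where "u = u1 @ u2" "path E r w u1 s" "path E s w' u2 q" by blast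
    then have "v @ u = (v @ u1) @ u2" "path E p w (v @ u1) s" "path E s w' u2 q"
      using path_None.hyps by (auto intro: path.intros)
    then show ?case by blast
  qed
  then show ?thesis using assms that by blast
qed

section \<open>The triple construction for the image of a language under a transducer\<close>

definition suffs :: "('n \<times> ('n, 't) sym list) set \<Rightarrow> ('n, 't) sym list set" where
  "suffs R = {c. \<exists>X u. (X, u @ c) \<in> R}"

lemma suffs_intro: "(X, r) \<in> R \<Longrightarrow> r \<in> suffs R"
  unfolding suffs_def by (auto intro!: exI[of _ X] exI[of _ "[]"])

lemma suffs_tl: "s # c \<in> suffs R \<Longrightarrow> c \<in> suffs R"
proof -
  assume "s # c \<in> suffs R"
  then obtain X u where "(X, (u @ [s]) @ c) \<in> R" unfolding suffs_def by auto
  then show "c \<in> suffs R" unfolding suffs_def by blast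
qed

lemma suffs_eq: "suffs R = (\<Union>(X, r)\<in>R. (\<lambda>j. drop j r) ` UNIV)"
proof (rule subset_antisym; rule subsetI)
  fix c assume "c \<in> suffs R"
  then obtain X u where "(X, u @ c) \<in> R" unfolding suffs_def by blast
  moreover have "c = drop (length u) (u @ c)" by simp
  ultimately show "c \<in> (\<Union>(X, r)\<in>R. (\<lambda>j. drop j r) ` UNIV)" by blast
next
  fix c assume "c \<in> (\<Union>(X, r)\<in>R. (\<lambda>j. drop j r) ` UNIV)"
  then obtain X r j where "(X, r) \<in> R" "c = drop j r" by blast
  then have "(X, take j r @ c) \<in> R" by simp
  then show "c \<in> suffs R" unfolding suffs_def by blast
qed

lemma finite_suffs: "finite R \<Longrightarrow> finite (suffs R)"
proof -
  have "(\<lambda>j. drop j r) ` UNIV \<subseteq> (\<lambda>j. drop j r) ` {..length r}" for r :: "('n, 't) sym list"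
  proof
    fix c assume "c \<in> (\<lambda>j. drop j r) ` UNIV"
    then obtain j where "c = drop j r" by blast
    then have "c = drop (min j (length r)) r" by (simp add: min_def)
    then show "c \<in> (\<lambda>j. drop j r) ` {..length r}" by auto
  qed
  then have "finite ((\<lambda>j. drop j r) ` UNIV)" for r :: "('n, 't) sym list"
    using finite_subset by blast
  then show "finite R \<Longrightarrow> finite (suffs R)" unfolding suffs_eq by auto
qed

text \<open>
  The triple \<open>(p, c, q)\<close> generates the outputs, along paths from \<open>p\<close> to \<open>q\<close>, of the words derived
  from \<open>c\<close>. Only suffixes \<open>c\<close> of right-hand sides are needed, so that the number of rules is
  polynomial in the size of the grammar.
\<close>

fun local_rules ::
    "('q \<times> 'x option \<times> 'y list \<times> 'q) set \<Rightarrow> 'q set \<Rightarrow> ('n, 'x) sym list \<Rightarrow>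
      (('q \<times> ('n, 'x) sym list \<times> 'q) \<times> ('q \<times> ('n, 'x) sym list \<times> 'q, 'y) sym list) set" where
  "local_rules E Q [] = {}"
| "local_rules E Q (NT X # c) =
     (\<Union>p\<in>Q. \<Union>r\<in>Q. \<Union>q\<in>Q. {((p, NT X # c, q), [NT (p, [NT X], r), NT (r, c, q)])})"
| "local_rules E Q (Tm a # c) =
     (\<Union>(p, x, v, r)\<in>E. \<Union>q\<in>Q. if x = Some a then {((p, Tm a # c, q), map Tm v @ [NT (r, c, q)])} else {})"

definition eps_rules ::
    "('q \<times> 'x option \<times> 'y list \<times> 'q) set \<Rightarrow> 'q set \<Rightarrow> ('n, 'x) sym list \<Rightarrow>
      (('q \<times> ('n, 'x) sym list \<times> 'q) \<times> ('q \<times> ('n, 'x) sym list \<times> 'q, 'y) sym list) set" where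
  "eps_rules E Q c =
     (\<Union>(p, x, v, r)\<in>E. \<Union>q\<in>Q. if x = None then {((p, c, q), map Tm v @ [NT (r, c, q)])} else {})"

text \<open>A triple \<open>(p, [NT X], q)\<close> is expanded by the rules for \<open>X\<close>,
  and is also split by \<open>local_rules\<close> if \<open>[NT X]\<close> happens to be a suffix.
  Both kinds of rules respect the same meaning of the triple, so the overlap does no harm.\<close>

definition trans_rules ::
    "('q \<times> 'x option \<times> 'y list \<times> 'q) set \<Rightarrow> 'q set \<Rightarrow> ('n \<times> ('n, 'x) sym list) set \<Rightarrow>
      (('q \<times> ('n, 'x) sym list \<times> 'q) \<times> ('q \<times> ('n, 'x) sym list \<times> 'q, 'y) sym list) set" where
  "trans_rules E Q R =
     (\<Union>p\<in>Q. {((p, [], p), [])}) \<union>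
     (\<Union>(X, c)\<in>R. \<Union>p\<in>Q. \<Union>q\<in>Q. {((p, [NT X], q), [NT (p, c, q)])}) \<union>
     (\<Union>c\<in>suffs R. eps_rules E Q c \<union> local_rules E Q c)"

lemma finite_trans_rules:
  fixes R :: "('n \<times> ('n, 'x) sym list) set"
  assumes "finite E" "finite Q" "finite R"
  shows "finite (trans_rules E Q R)"
proof -
  have "finite (local_rules E Q c)" for c :: "('n, 'x) sym list"
    by (cases "(E, Q, c)" rule: local_rules.cases) (use assms in auto)
  moreover have "finite (eps_rules E Q c)" for c :: "('n, 'x) sym list"
    using assms by (auto simp: eps_rules_def)
  ultimately show ?thesis using assms finite_suffs[OF assms(3)] unfolding trans_rules_def by auto
qed

lemma trans_rules_over:
  fixes R :: "('n \<times> ('n, 'x) sym list) set"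
  assumes "\<And>p x v r. (p, x, v, r) \<in> E \<Longrightarrow> v \<in> lists \<Sigma>"
  shows "rules_over \<Sigma> (trans_rules E Q R)"
proof -
  have "rules_over \<Sigma> (local_rules E Q c)" for c :: "('n, 'x) sym list"
    by (cases "(E, Q, c)" rule: local_rules.cases)
      (use assms in \<open>fastforce simp: rules_over_def in_lists_conv_set split: if_splits\<close>)+
  moreover have "rules_over \<Sigma> (eps_rules E Q c)" for c :: "('n, 'x) sym list"
    using assms by (fastforce simp: rules_over_def eps_rules_def in_lists_conv_set split: if_splits)
  ultimately show ?thesis unfolding trans_rules_def rules_over_def by auto
qed

text \<open>By \<open>yields_matches\<close>, it is enough that the intended meaning
  \<open>P\<close> of the triples is compatible with each rule.\<close>

lemma trans_rules_sound:
  assumes "yields (trans_rules E Q R) [NT (p, c, q)] u"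
  shows "\<exists>w. yields R c w \<and> path E p w u q"
proof -
  define P where "P = (\<lambda>(p, c, q) u. \<exists>w. yields R c w \<and> path E p w u q)"
  have "matches P [NT (p, c, q)] u"
    using assms
  proof (rule yields_matches)
    fix Y s u assume Y: "(Y, s) \<in> trans_rules E Q R" and m: "matches P s u"
    from Y consider p where "Y = (p, [], p)" "s = []"
      | X c p q where "(X, c) \<in> R" "Y = (p, [NT X], q)" "s = [NT (p, c, q)]"
      | c where "(Y, s) \<in> eps_rules E Q c" | c where "(Y, s) \<in> local_rules E Q c"
      unfolding trans_rules_def by blast
    then show "P Y u"
    proof cases
      case 1
      then show ?thesis using m by (auto simp: P_def intro: yields.intros path.intros)
    next
      case 2
      then show ?thesis using m by (auto simp: P_def intro: yields_rule)
    next
      case (3 c)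
      then show ?thesis using m
        by (fastforce simp: eps_rules_def P_def matches_map_Tm_append intro: path_None split: if_splits)
    next
      case (4 c)
      show ?thesis
      proof (cases "(E, Q, c)" rule: local_rules.cases)
        case (2 E' Q' X c')
        then obtain p q r where *: "Y = (p, NT X # c', q)" "s = [NT (p, [NT X], r), NT (r, c', q)]"
          using 4 by auto
        then obtain u1 u2 w1 w2 where "u = u1 @ u2" "yields R [NT X] w1" "path E p w1 u1 r"
          "yields R c' w2" "path E r w2 u2 q" using m by (auto simp: P_def)
        then have "yields R ([NT X] @ c') (w1 @ w2)" "path E p (w1 @ w2) u q"
          by (blast intro: yields_append path_append)+
        then show ?thesis using * by (auto simp: P_def)
      next
        case (3 E' Q' a c')
        then obtain p q r v where *: "Y = (p, Tm a # c', q)" "s = map Tm v @ [NT (r, c', q)]"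
          "(p, Some a, v, r) \<in> E"
          using 4 by (auto split: if_splits)
        then show ?thesis using m
          by (auto simp: P_def matches_map_Tm_append) (blast intro: yields_Tm path_Some)
      qed (use 4 in auto)
    qed
  qed
  then show ?thesis by (simp add: P_def)
qed

lemma yields_output:
  "(Y, map Tm v @ [NT Z]) \<in> R \<Longrightarrow> yields R [NT Z] u \<Longrightarrow> yields R [NT Y] (v @ u)"
  by (rule yields_rule) (auto intro: yields_append yields_map_Tm)

text \<open>The outer induction is on the derivation, since \<open>c\<close> determines which rule
  of the new grammar applies. Edges that read nothing can precede the next letter; an inner
  induction on the path absorbs them by \<open>eps_rules\<close>, which leave \<open>c\<close>
  unchanged.\<close>

lemma trans_rules_complete_suffix:
  assumes E: "\<And>p x v r. (p, x, v, r) \<in> E \<Longrightarrow> p \<in> Q \<and> r \<in> Q"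
    and Q: "p \<in> Q" "q \<in> Q"
    and y: "yields R c w" "c \<in> suffs R" "path E p w u q"
  shows "yields (trans_rules E Q R) [NT (p, c, q)] u"
proof -
  let ?R = "trans_rules E Q R"
  have eps: "yields ?R [NT (p, c, q)] (v @ u)"
    if "(p, None, v, r) \<in> E" "q \<in> Q" "c \<in> suffs R" "yields ?R [NT (r, c, q)] u" for p v r q c u
  proof (rule yields_output[OF _ that(4)])
    have "((p, c, q), map Tm v @ [NT (r, c, q)]) \<in> eps_rules E Q c"
      using that unfolding eps_rules_def by force
    then show "((p, c, q), map Tm v @ [NT (r, c, q)]) \<in> ?R"
      using that unfolding trans_rules_def by blast
  qed
  have pathQ: "path E p w u q \<Longrightarrow> p \<in> Q \<Longrightarrow> q \<in> Q" for p w u q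
    by (induction rule: path.induct) (auto dest: E)
  from y Q show ?thesis
  proof (induction arbitrary: p q u rule: yields.induct)
    case yields_Nil
    have "path E p w u q \<Longrightarrow> w = [] \<Longrightarrow> p \<in> Q \<Longrightarrow> q \<in> Q \<Longrightarrow> yields ?R [NT (p, [], q)] u" for w
    proof (induction rule: path.induct)
      case (path_refl p)
      then have "((p, [], p), []) \<in> ?R" unfolding trans_rules_def by blast
      then show ?case using yields_rule yields.yields_Nil by fast
    next
      case (path_None p v r w u q)
      then show ?case using eps[OF path_None(1)] yields_Nil E by blast
    qed simp
    then show ?case using yields_Nil by blast
  next
    case (yields_Tm c w a)
    have "path E p x u q \<Longrightarrow> x = a # w \<Longrightarrow> p \<in> Q \<Longrightarrow> q \<in> Q \<Longrightarrow> yields ?R [NT (p, Tm a # c, q)] u" for x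
    proof (induction rule: path.induct)
      case (path_Some p b v r x u q)
      then have "b = a" "x = w" "r \<in> Q" using E by auto
      have "((p, Tm a # c, q), map Tm v @ [NT (r, c, q)]) \<in> local_rules E Q (Tm a # c)"
        using path_Some \<open>b = a\<close> by force
      then have "((p, Tm a # c, q), map Tm v @ [NT (r, c, q)]) \<in> ?R"
        using yields_Tm.prems unfolding trans_rules_def by blast
      moreover have "yields ?R [NT (r, c, q)] u"
        using yields_Tm.IH suffs_tl[OF yields_Tm.prems(1)] path_Some \<open>x = w\<close> \<open>r \<in> Q\<close> by blast
      ultimately show ?case by (rule yields_output)
    next
      case (path_None p v r w u q)
      then show ?case using eps[OF path_None(1)] yields_Tm.prems E by blast
    qed simp
    then show ?case using yields_Tm by blast
  next
    case (yields_NT X r w1 c w2)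
    \<comment> \<open>The state in which the path stands after the word derived from
      \<open>X\<close> is the middle state guessed by the splitting rule.\<close>
    from path_appendE[OF yields_NT.prems(2)] obtain s u1 u2 where
      s: "u = u1 @ u2" "path E p w1 u1 s" "path E s w2 u2 q" by metis
    have sQ: "s \<in> Q" using pathQ s yields_NT by blast
    have "yields ?R [NT (p, r, s)] u1"
      using yields_NT.IH(1)[OF suffs_intro[OF yields_NT.hyps(1)] s(2)] yields_NT.prems sQ by blast
    moreover have "((p, [NT X], s), [NT (p, r, s)]) \<in> ?R"
      using yields_NT.hyps(1) yields_NT.prems sQ unfolding trans_rules_def by blast
    ultimately have "yields ?R [NT (p, [NT X], s)] u1" by (blast intro: yields_rule)
    moreover have "yields ?R [NT (s, c, q)] u2"
      using yields_NT.IH(2)[OF suffs_tl[OF yields_NT.prems(1)] s(3)] yields_NT.prems sQ by blast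
    ultimately have "yields ?R [NT (p, [NT X], s), NT (s, c, q)] u"
      unfolding s using yields_append by fastforce
    moreover have "((p, NT X # c, q), [NT (p, [NT X], s), NT (s, c, q)]) \<in> local_rules E Q (NT X # c)"
      using yields_NT.prems sQ by auto
    then have "((p, NT X # c, q), [NT (p, [NT X], s), NT (s, c, q)]) \<in> ?R"
      using yields_NT.prems unfolding trans_rules_def by blast
    ultimately show ?case by (blast intro: yields_rule)
  qed
qed

text \<open>The start symbol on its own need not be a suffix of a right-hand side, so its expansion
  is treated apart, before the suffix lemma takes over.\<close>

theorem yields_trans_rules_iff:
  assumes E: "\<And>p x v r. (p, x, v, r) \<in> E \<Longrightarrow> p \<in> Q \<and> r \<in> Q" and Q: "p \<in> Q" "q \<in> Q"
  shows "yields (trans_rules E Q R) [NT (p, [NT S], q)] u \<longleftrightarrow>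
    (\<exists>w. yields R [NT S] w \<and> path E p w u q)"
proof
  assume "\<exists>w. yields R [NT S] w \<and> path E p w u q"
  then obtain w r where w: "(S, r) \<in> R" "yields R r w" "path E p w u q"
    by (auto elim: yields_singleE)
  then have "((p, [NT S], q), [NT (p, r, q)]) \<in> trans_rules E Q R"
    using Q unfolding trans_rules_def by blast
  moreover have "yields (trans_rules E Q R) [NT (p, r, q)] u"
    using trans_rules_complete_suffix[OF E Q w(2) suffs_intro[OF w(1)] w(3)] .
  ultimately show "yields (trans_rules E Q R) [NT (p, [NT S], q)] u" by (rule yields_rule)
qed (rule trans_rules_sound)

theorem context_free_transduction:
  assumes "context_free \<Sigma> L" "finite E" "finite Q" "p \<in> Q" "q \<in> Q"
    and E: "\<And>p x v r. (p, x, v, r) \<in> E \<Longrightarrow> p \<in> Q \<and> r \<in> Q \<and> v \<in> lists \<Delta>"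
  shows "context_free \<Delta> {u. \<exists>w\<in>L. path E p w u q}"
proof -
  obtain R :: "(nat \<times> (nat, _) sym list) set" and S
    where R: "finite R" "L = {w. yields R [NT S] w}" by (rule context_freeE[OF assms(1)])
  have "context_free \<Delta> {u. yields (trans_rules E Q R) [NT (p, [NT S], q)] u}"
    using E by (intro context_freeI finite_trans_rules[OF assms(2,3) R(1)] trans_rules_over) blast
  moreover have "{u. yields (trans_rules E Q R) [NT (p, [NT S], q)] u} = {u. \<exists>w\<in>L. path E p w u q}"
    using yields_trans_rules_iff[of E Q p q R S] assms(4,5) E unfolding R(2) by auto
  ultimately show ?thesis by simp
qed

subsection \<open>Sequential machines\<close>

fun outputs :: "('q \<Rightarrow> 'x \<Rightarrow> 'q) \<Rightarrow> ('q \<Rightarrow> 'x \<Rightarrow> 'y list) \<Rightarrow> 'q \<Rightarrow> 'x list \<Rightarrow> 'y list" where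
  "outputs \<delta> \<beta> p [] = []"
| "outputs \<delta> \<beta> p (a # w) = \<beta> p a @ outputs \<delta> \<beta> (\<delta> p a) w"

definition machine_edges ::
    "('q \<Rightarrow> 'x \<Rightarrow> 'q) \<Rightarrow> ('q \<Rightarrow> 'x \<Rightarrow> 'y list) \<Rightarrow> 'q set \<Rightarrow> 'x set \<Rightarrow> ('q \<times> 'x option \<times> 'y list \<times> 'q) set"
  where "machine_edges \<delta> \<beta> Q \<Sigma> = {(p, Some a, \<beta> p a, \<delta> p a) | p a. p \<in> Q \<and> a \<in> \<Sigma>}"

lemma path_machine_edges_iff:
  assumes "\<And>p a. p \<in> Q \<Longrightarrow> a \<in> \<Sigma> \<Longrightarrow> \<delta> p a \<in> Q" "p \<in> Q"
  shows "path (machine_edges \<delta> \<beta> Q \<Sigma>) p w u q \<longleftrightarrow>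
    w \<in> lists \<Sigma> \<and> foldl \<delta> p w = q \<and> u = outputs \<delta> \<beta> p w"
proof
  show "path (machine_edges \<delta> \<beta> Q \<Sigma>) p w u q \<Longrightarrow> w \<in> lists \<Sigma> \<and> foldl \<delta> p w = q \<and> u = outputs \<delta> \<beta> p w"
    by (induction rule: path.induct) (auto simp: machine_edges_def)
  have "w \<in> lists \<Sigma> \<Longrightarrow> p \<in> Q \<Longrightarrow> path (machine_edges \<delta> \<beta> Q \<Sigma>) p w (outputs \<delta> \<beta> p w) (foldl \<delta> p w)"
  proof (induction w arbitrary: p)
    case (Cons a w)
    then have "(p, Some a, \<beta> p a, \<delta> p a) \<in> machine_edges \<delta> \<beta> Q \<Sigma>" by (auto simp: machine_edges_def)
    then show ?case using Cons assms(1) by (auto intro: path_Some)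
  qed (simp add: path_refl)
  then show "w \<in> lists \<Sigma> \<and> foldl \<delta> p w = q \<and> u = outputs \<delta> \<beta> p w \<Longrightarrow> path (machine_edges \<delta> \<beta> Q \<Sigma>) p w u q"
    using assms(2) by blast
qed

section \<open>Inverse images under sequential machines\<close>

text \<open>
  The inverse of a machine followed by a fixed word \<open>t\<close>: the second component of a state is the part
  of the outputs of the machine that is still to be read; after the last letter, which is guessed,
  the first component is \<open>None\<close>.
\<close>

inductive_set inverse_edges ::
    "('q \<Rightarrow> 'x \<Rightarrow> 'q) \<Rightarrow> ('q \<Rightarrow> 'x \<Rightarrow> 'y list) \<Rightarrow> 'q set \<Rightarrow> 'x set \<Rightarrow> 'q \<Rightarrow> 'y list \<Rightarrow> 'y list set \<Rightarrow>
      (('q option \<times> 'y list) \<times> 'y option \<times> 'x list \<times> ('q option \<times> 'y list)) set"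
  for \<delta> \<beta> Q \<Sigma> q t V where
  "p \<in> Q \<Longrightarrow> a \<in> \<Sigma> \<Longrightarrow>
    ((Some p, []), None, [a], (Some (\<delta> p a), \<beta> p a)) \<in> inverse_edges \<delta> \<beta> Q \<Sigma> q t V"
| "((Some q, []), None, [], (None, t)) \<in> inverse_edges \<delta> \<beta> Q \<Sigma> q t V"
| "s \<in> insert None (Some ` Q) \<Longrightarrow> b # v \<in> V \<Longrightarrow>
    ((s, b # v), Some b, [], (s, v)) \<in> inverse_edges \<delta> \<beta> Q \<Sigma> q t V"

lemma inverse_edgesE:
  assumes "(s, x, v, r) \<in> inverse_edges \<delta> \<beta> Q \<Sigma> q t V"
  obtains p a where "p \<in> Q" "a \<in> \<Sigma>" "s = (Some p, [])" "x = None" "v = [a]"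
      "r = (Some (\<delta> p a), \<beta> p a)"
    | "s = (Some q, [])" "x = None" "v = []" "r = (None, t)"
    | o' b y where "o' \<in> insert None (Some ` Q)" "b # y \<in> V" "s = (o', b # y)" "x = Some b" "v = []"
      "r = (o', y)"
proof (cases s; cases r)
  fix s1 s2 r1 r2 assume *: "s = (s1, s2)" "r = (r1, r2)"
  from assms[unfolded *] show thesis
    by cases (use that * in auto)
qed

text \<open>The conjuncts are the meanings of the two kinds of states. In \<open>(Some p, y)\<close>
  the state \<open>p\<close> is already the one after the guessed letter, while \<open>y\<close> is
  what is still to be read of the output of that letter. The end state is given by an equation to
  keep it general in the induction.\<close>

lemma path_inverse_edges_sound:
  assumes "path (inverse_edges \<delta> \<beta> Q \<Sigma> q t V) s x w e" "e = (None, [])"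
  shows "(fst s = None \<longrightarrow> w = [] \<and> x = snd s) \<and>
    (\<forall>p. fst s = Some p \<longrightarrow>
      w \<in> lists \<Sigma> \<and> foldl \<delta> p w = q \<and> x = snd s @ outputs \<delta> \<beta> p w @ t)"
  using assms
proof (induction rule: path.induct)
  case (path_Some p a v r w u e)
  from path_Some(1) obtain s y where s: "p = (s, a # y)" "v = []" "r = (s, y)"
    by (rule inverse_edgesE) auto
  show ?case using path_Some(3,4) unfolding s by simp
next
  case (path_None p v r w u e)
  from path_None(1) consider p' a where "a \<in> \<Sigma>" "p = (Some p', [])" "v = [a]" "r = (Some (\<delta> p' a), \<beta> p' a)"
    | "p = (Some q, [])" "v = []" "r = (None, t)"
    by (rule inverse_edgesE) auto
  then show ?case
  proof cases
    case 1
    then show ?thesis using path_None(3,4) by simp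
  next
    case 2
    then show ?thesis using path_None(3,4) by simp
  qed
qed simp

lemma path_inverse_edges_complete:
  assumes Q: "\<And>p a. p \<in> Q \<Longrightarrow> a \<in> \<Sigma> \<Longrightarrow> \<delta> p a \<in> Q"
    and V: "\<And>b v. b # v \<in> V \<Longrightarrow> v \<in> V" "\<And>p a. p \<in> Q \<Longrightarrow> a \<in> \<Sigma> \<Longrightarrow> \<beta> p a \<in> V" "t \<in> V"
    and p: "p \<in> Q" "w \<in> lists \<Sigma>"
  shows "path (inverse_edges \<delta> \<beta> Q \<Sigma> (foldl \<delta> p w) t V) (Some p, []) (outputs \<delta> \<beta> p w @ t) w (None, [])"
proof -
  have read: "path (inverse_edges \<delta> \<beta> Q \<Sigma> q t V) (s, v) v [] (s, [])"
    if "s \<in> insert None (Some ` Q)" "v \<in> V" for s v q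
    using that
  proof (induction v)
    case (Cons b v)
    then show ?case
      using path_Some[OF inverse_edges.intros(3)[of s Q b v V] Cons.IH] V(1) by simp
  qed (rule path_refl)
  from p show ?thesis
  proof (induction w arbitrary: p)
    case Nil
    then show ?case
      using path_None[OF inverse_edges.intros(2) read[of None t]] V(3) by simp
  next
    case (Cons a w)
    then have a: "a \<in> \<Sigma>" "w \<in> lists \<Sigma>" "\<delta> p a \<in> Q" "\<beta> p a \<in> V" using Q V by auto
    let ?E = "inverse_edges \<delta> \<beta> Q \<Sigma> (foldl \<delta> (\<delta> p a) w) t V"
    have "path ?E (Some (\<delta> p a), \<beta> p a) (\<beta> p a @ outputs \<delta> \<beta> (\<delta> p a) w @ t) ([] @ w) (None, [])"
      using a by (intro path_append[OF read Cons.IH]) auto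
    then show ?case
      using path_None[OF inverse_edges.intros(1)[of p Q a \<Sigma>]] Cons.prems a by fastforce
  qed
qed

theorem context_free_inverse_machine:
  assumes L: "context_free \<Delta> L" and fin: "finite Q" "finite \<Sigma>"
    and Q: "\<And>p a. p \<in> Q \<Longrightarrow> a \<in> \<Sigma> \<Longrightarrow> \<delta> p a \<in> Q" and p: "p \<in> Q" "q \<in> Q"
  shows "context_free \<Sigma> {w \<in> lists \<Sigma>. foldl \<delta> p w = q \<and> outputs \<delta> \<beta> p w @ t \<in> L}"
proof -
  \<comment> \<open>All suffixes of the possible pending outputs: closed under reading a letter, yet
    finite, so that the inverse machine has finitely many states.\<close>
  define V where "V = (\<Union>x\<in>insert t ((\<lambda>(p, a). \<beta> p a) ` (Q \<times> \<Sigma>)). (\<lambda>j. drop j x) ` {..length x})"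
  have finV: "finite V" using fin by (auto simp: V_def)
  have V0: "x \<in> V" if "x = t \<or> (\<exists>p\<in>Q. \<exists>a\<in>\<Sigma>. x = \<beta> p a)" for x
  proof -
    have "x \<in> (\<lambda>j. drop j x) ` {..length x}" by (rule image_eqI[of _ _ 0]) auto
    then show ?thesis using that unfolding V_def by blast
  qed
  have nilV: "[] \<in> V"
    unfolding V_def by (auto intro!: image_eqI[of _ _ "length t"])
  have V1: "v \<in> V" if "b # v \<in> V" for b v
  proof -
    from that obtain x j where x: "x \<in> insert t ((\<lambda>(p, a). \<beta> p a) ` (Q \<times> \<Sigma>))" "b # v = drop j x"
      unfolding V_def by blast
    then have "v = drop (Suc j) x" by (metis drop_Suc list.sel(3) tl_drop)
    moreover have "Suc j \<le> length x" using x(2) by (metis Suc_leI drop_eq_Nil list.distinct(1) not_le)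
    ultimately show ?thesis using x(1) unfolding V_def by blast
  qed
  let ?E = "inverse_edges \<delta> \<beta> Q \<Sigma> q t V"
  let ?S = "insert None (Some ` Q) \<times> V"
  have E: "s \<in> ?S \<and> r \<in> ?S \<and> v \<in> lists \<Sigma>" if "(s, x, v, r) \<in> ?E" for s x v r
  proof -
    have "t \<in> V" "\<And>p a. p \<in> Q \<Longrightarrow> a \<in> \<Sigma> \<Longrightarrow> \<beta> p a \<in> V" using V0 by blast+
    then show ?thesis using that by (elim inverse_edgesE) (use Q p nilV V1 in auto)
  qed
  have "?E \<subseteq> ?S \<times> insert None (Some ` \<Union>(set ` V)) \<times> ({[]} \<union> (\<lambda>a. [a]) ` \<Sigma>) \<times> ?S"
  proof
    fix e assume e: "e \<in> ?E"
    obtain s x v r where "e = (s, x, v, r)" by (cases e)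
    moreover from e[unfolded this] have "x \<in> insert None (Some ` \<Union>(set ` V)) \<and> v \<in> {[]} \<union> (\<lambda>a. [a]) ` \<Sigma>"
      by (rule inverse_edgesE) force+
    ultimately show "e \<in> ?S \<times> insert None (Some ` \<Union>(set ` V)) \<times> ({[]} \<union> (\<lambda>a. [a]) ` \<Sigma>) \<times> ?S"
      using E e by blast
  qed
  then have "finite ?E" by (rule finite_subset) (use finV fin in auto)
  then have "context_free \<Sigma> {w. \<exists>x\<in>L. path ?E (Some p, []) x w (None, [])}"
    using context_free_transduction[OF L, of ?E ?S "(Some p, [])" "(None, [])" \<Sigma>] fin finV p nilV E
    by blast
  moreover have "path ?E (Some p, []) x w (None, []) \<longleftrightarrow>
      w \<in> lists \<Sigma> \<and> foldl \<delta> p w = q \<and> x = outputs \<delta> \<beta> p w @ t" for x w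
  proof
    show "path ?E (Some p, []) x w (None, []) \<Longrightarrow> w \<in> lists \<Sigma> \<and> foldl \<delta> p w = q \<and> x = outputs \<delta> \<beta> p w @ t"
      using path_inverse_edges_sound[of \<delta> \<beta> Q \<Sigma> q t V "(Some p, [])" x w "(None, [])"] by simp
    show "w \<in> lists \<Sigma> \<and> foldl \<delta> p w = q \<and> x = outputs \<delta> \<beta> p w @ t \<Longrightarrow> path ?E (Some p, []) x w (None, [])"
      using path_inverse_edges_complete[of Q \<Sigma> \<delta> V \<beta> t p w] Q V1 V0 p by blast
  qed
  ultimately show ?thesis by (simp add: Bex_def)
qed

section \<open>Subgroups of finite index\<close>

context group
begin

lemma letter_val_closed: "A \<subseteq> carrier G \<Longrightarrow> x \<in> tilde A \<Longrightarrow> letter_val G x \<in> carrier G"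
  by (auto simp: tilde_def)

lemma word_val_closed: "A \<subseteq> carrier G \<Longrightarrow> w \<in> lists (tilde A) \<Longrightarrow> word_val G w \<in> carrier G"
  by (induction w) (auto intro: letter_val_closed)

lemma word_val_append:
  "A \<subseteq> carrier G \<Longrightarrow> u \<in> lists (tilde A) \<Longrightarrow> v \<in> lists (tilde A) \<Longrightarrow>
    word_val G (u @ v) = word_val G u \<otimes> word_val G v"
  by (induction u) (auto simp: m_assoc letter_val_closed word_val_closed[simplified in_lists_conv_set])

lemma word_val_surj:
  assumes A: "A \<subseteq> carrier G" and x: "x \<in> generate G A"
  shows "\<exists>w\<in>lists (tilde A). word_val G w = x"
  using x
proof induction
  case one
  then show ?case by (intro bexI[of _ "[]"]) auto
next
  case (incl h)
  then show ?case using A by (intro bexI[of _ "[Pos h]"]) (auto simp: tilde_def)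
next
  case (inv h)
  then show ?case using A by (intro bexI[of _ "[Neg h]"]) (auto simp: tilde_def)
next
  case (eng h1 h2)
  then obtain u v where "u \<in> lists (tilde A)" "v \<in> lists (tilde A)" "word_val G u = h1" "word_val G v = h2"
    by blast
  then show ?case using word_val_append[OF A, of u v] by (intro bexI[of _ "u @ v"]) auto
qed

lemma word_val_subgroup:
  assumes "subgroup H G" "B \<subseteq> H" "w \<in> lists (tilde B)"
  shows "word_val (G\<lparr>carrier := H\<rparr>) w = word_val G w"
proof -
  have "letter_val (G\<lparr>carrier := H\<rparr>) x = letter_val G x" if "x \<in> tilde B" for x
    using that assms(1,2) m_inv_consistent[OF assms(1)] by (auto simp: tilde_def)
  then show ?thesis using assms(3) by (induction w) auto
qed

end

locale finite_index_subgroup = group G for G (structure) +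
  fixes A B H
  assumes fin: "finite A" "finite B" "finite (rcosets H)"
    and A: "A \<subseteq> carrier G" "generate G A = carrier G"
    and B: "B \<subseteq> H" "generate G B = H"
    and H: "subgroup H G"
begin

abbreviation "GH \<equiv> G\<lparr>carrier := H\<rparr>"

lemma H_subset: "H \<subseteq> carrier G"
  using H by (rule subgroup.subset)

lemma B_subset: "B \<subseteq> carrier G"
  using B H_subset by blast

lemma finite_tilde: "finite (tilde A)" "finite (tilde B)"
  using fin by (auto simp: tilde_def)

lemma word_val_H: "w \<in> lists (tilde B) \<Longrightarrow> word_val G w \<in> H"
proof (induction w)
  case Nil
  then show ?case using subgroup.one_closed[OF H] by simp
next
  case (Cons x w)
  then have "letter_val G x \<in> H"
    using B subgroup.m_inv_closed[OF H] by (auto simp: tilde_def)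
  then show ?case using Cons subgroup.m_closed[OF H] by auto
qed

section \<open>Coset representatives and rewriting\<close>

lemma coset_subset: "C \<in> rcosets H \<Longrightarrow> C \<subseteq> carrier G"
  using rcosets_part_G[OF H] by blast

lemma coset_eq: "C \<in> rcosets H \<Longrightarrow> x \<in> C \<Longrightarrow> C = H #> x"
  using repr_independence[OF _ _ H] coset_subset H unfolding RCOSETS_def by auto

lemma H_coset: "H \<in> rcosets H"
  using subgroup.subgroup_in_rcosets[OF H] is_group by blast

text \<open>With \<open>\<one>\<close> as representative of \<open>H\<close>, rewriting that starts
  in \<open>H\<close> changes the value of a word only by a factor on the right. It also makes the
  part of a subset in the coset \<open>H\<close> literal.\<close>

definition rep :: "'a set \<Rightarrow> 'a" where
  "rep C = (if C = H then \<one> else SOME x. x \<in> C)"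

lemma rep_in: "C \<in> rcosets H \<Longrightarrow> rep C \<in> C"
proof -
  assume C: "C \<in> rcosets H"
  then have "\<exists>x. x \<in> C" using subgroup.rcosets_non_empty[OF H] by blast
  then have "(SOME x. x \<in> C) \<in> C" by (rule someI_ex)
  then show ?thesis using subgroup.one_closed[OF H] by (simp add: rep_def)
qed

lemma rep_closed: "C \<in> rcosets H \<Longrightarrow> rep C \<in> carrier G"
  using rep_in coset_subset by blast

lemma coset_rep: "C \<in> rcosets H \<Longrightarrow> H #> rep C = C"
  using coset_eq rep_in by blast

lemma rep_H: "rep H = \<one>"
  by (simp add: rep_def)

text \<open>The choice operator is compatible with computability: a transducer contains only
  finitely many of these words, and they enter the programs as constants.\<close>

definition word :: "'a set \<Rightarrow> 'a \<Rightarrow> 'a letter list" where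
  "word X x = (SOME w. w \<in> lists (tilde X) \<and> word_val G w = x)"

lemma word_spec:
  assumes "X \<subseteq> carrier G" "x \<in> generate G X"
  shows "word X x \<in> lists (tilde X)" "word_val G (word X x) = x"
proof -
  have "word X x \<in> lists (tilde X) \<and> word_val G (word X x) = x"
    unfolding word_def by (rule someI_ex[OF word_val_surj[OF assms, unfolded Bex_def]])
  then show "word X x \<in> lists (tilde X)" "word_val G (word X x) = x" by auto
qed

text \<open>The machine that performs the Reidemeister--Schreier rewriting of words over \<open>A\<close>.\<close>

definition move :: "'a set \<Rightarrow> 'a letter \<Rightarrow> 'a set" where
  "move C x = C #> letter_val G x"

text \<open>A word for the Schreier generator of the coset \<open>C\<close> and the letter
  \<open>x\<close>. That element lies in \<open>H\<close> because \<open>rep C\<close> times the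
  value of \<open>x\<close> lies in the coset \<open>move C x\<close>.\<close>

definition rewrite :: "'a set \<Rightarrow> 'a letter \<Rightarrow> 'a letter list" where
  "rewrite C x = word B (rep C \<otimes> letter_val G x \<otimes> inv (rep (move C x)))"

lemma move_coset:
  assumes "C \<in> rcosets H" "x \<in> carrier G"
  shows "C #> x \<in> rcosets H" "C #> x = H #> (rep C \<otimes> x)"
proof -
  have "(H #> rep C) #> x = H #> (rep C \<otimes> x)"
    using coset_mult_assoc[OF H_subset rep_closed[OF assms(1)] assms(2)] .
  then show *: "C #> x = H #> (rep C \<otimes> x)" using coset_rep[OF assms(1)] by simp
  show "C #> x \<in> rcosets H"
    unfolding * using rcosetsI[OF H_subset] rep_closed[OF assms(1)] assms(2) by simp
qed

lemma move_in: "C \<in> rcosets H \<Longrightarrow> x \<in> tilde A \<Longrightarrow> move C x \<in> rcosets H"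
  unfolding move_def using move_coset(1) letter_val_closed[OF A(1)] by blast

lemma rep_quotient:
  assumes "x \<in> carrier G" "C \<in> rcosets H" "H #> x = C"
  shows "x \<otimes> inv (rep C) \<in> H"
proof -
  have "x \<in> H #> rep C" using assms coset_rep rcos_self[OF _ H] by auto
  then obtain h where h: "h \<in> H" "x = h \<otimes> rep C" unfolding r_coset_def by auto
  then have "x \<otimes> inv (rep C) = h"
    using rep_closed[OF assms(2)] H_subset by (simp add: subsetD m_assoc)
  then show ?thesis using h by simp
qed

lemma rewrite_spec:
  assumes "C \<in> rcosets H" "x \<in> tilde A"
  shows "rewrite C x \<in> lists (tilde B)"
    "word_val G (rewrite C x) = rep C \<otimes> letter_val G x \<otimes> inv (rep (move C x))"
proof -
  have x: "letter_val G x \<in> carrier G" using assms letter_val_closed[OF A(1)] by blast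
  have "H #> (rep C \<otimes> letter_val G x) = move C x"
    unfolding move_def using move_coset[OF assms(1) x] by simp
  then have "rep C \<otimes> letter_val G x \<otimes> inv (rep (move C x)) \<in> H"
    using rep_quotient[OF _ move_in[OF assms]] x rep_closed[OF assms(1)] by simp
  then show "rewrite C x \<in> lists (tilde B)"
    "word_val G (rewrite C x) = rep C \<otimes> letter_val G x \<otimes> inv (rep (move C x))"
    unfolding rewrite_def using word_spec[OF B_subset] B(2) by simp_all
qed

lemma foldl_move:
  assumes "C \<in> rcosets H" "w \<in> lists (tilde A)"
  shows "foldl move C w = C #> word_val G w"
  using assms
proof (induction w arbitrary: C)
  case Nil
  then show ?case using coset_mult_one coset_subset by auto
next
  case (Cons x w)
  have "word_val G w \<in> carrier G" using word_val_closed[OF A(1), of w] Cons.prems by auto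
  then show ?case
    using Cons move_in coset_mult_assoc[OF coset_subset[OF Cons.prems(1)], of "letter_val G x" "word_val G w"]
      letter_val_closed[OF A(1)]
    by (simp add: move_def)
qed

lemma outputs_over:
  "C \<in> rcosets H \<Longrightarrow> w \<in> lists (tilde A) \<Longrightarrow> outputs move rewrite C w \<in> lists (tilde B)"
proof (induction w arbitrary: C)
  case (Cons x w)
  then have x: "x \<in> tilde A" "w \<in> lists (tilde A)" by auto
  show ?case
    using Cons.IH[OF move_in[OF Cons.prems(1) x(1)] x(2)] rewrite_spec(1)[OF Cons.prems(1) x(1)]
    by simp
qed simp

text \<open>The product of Schreier generators telescopes: the inverse representative that closes
  one factor cancels the representative that opens the next.\<close>

lemma word_val_outputs:
  assumes "C \<in> rcosets H" "w \<in> lists (tilde A)"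
  shows "word_val G (outputs move rewrite C w) = rep C \<otimes> word_val G w \<otimes> inv (rep (foldl move C w))"
  using assms
proof (induction w arbitrary: C)
  case Nil
  then show ?case using rep_closed by simp
next
  case (Cons x w)
  let ?D = "move C x" and ?E = "foldl move (move C x) w"
  have D: "?D \<in> rcosets H" using Cons.prems move_in by auto
  have "foldl move D v \<in> rcosets H" if "D \<in> rcosets H" "v \<in> lists (tilde A)" for D v
    using that move_in by (induction v arbitrary: D) auto
  then have E: "?E \<in> rcosets H" using D Cons.prems by auto
  have w: "word_val G w \<in> carrier G" using word_val_closed[OF A(1), of w] Cons.prems by auto
  have x: "letter_val G x \<in> carrier G" using letter_val_closed[OF A(1)] Cons.prems by auto
  have "word_val G (outputs move rewrite C (x # w)) =
      (rep C \<otimes> letter_val G x \<otimes> inv (rep ?D)) \<otimes> (rep ?D \<otimes> word_val G w \<otimes> inv (rep ?E))"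
    using Cons.prems D Cons.IH[OF D] rewrite_spec[of C x] outputs_over[OF D]
    by (simp add: word_val_append[OF B_subset])
  also have "\<dots> = rep C \<otimes> (letter_val G x \<otimes> word_val G w) \<otimes> inv (rep ?E)"
  proof -
    have "inv (rep ?D) \<otimes> (rep ?D \<otimes> y) = y" if "y \<in> carrier G" for y
      using that rep_closed[OF D] by (simp add: m_assoc[symmetric])
    then show ?thesis
      using rep_closed[OF Cons.prems(1)] rep_closed[OF D] rep_closed[OF E] w x
      by (simp add: m_assoc)
  qed
  finally show ?case by simp
qed

text \<open>The dummy state turns the substitution into a sequential machine with one state, to
  which the results on machines apply.\<close>

definition subst :: "unit \<Rightarrow> 'a letter \<Rightarrow> 'a letter list" where
  "subst p x = word A (letter_val G x)"

abbreviation "stay \<equiv> (\<lambda>(p :: unit) (x :: 'a letter). ())"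

lemma subst_spec:
  "x \<in> tilde B \<Longrightarrow> subst p x \<in> lists (tilde A)"
  "x \<in> tilde B \<Longrightarrow> word_val G (subst p x) = letter_val G x"
  unfolding subst_def using word_spec[OF A(1)] A(2) letter_val_closed[OF B_subset] by blast+

lemma outputs_subst:
  "w \<in> lists (tilde B) \<Longrightarrow> outputs stay subst p w \<in> lists (tilde A) \<and>
    word_val G (outputs stay subst p w) = word_val G w"
proof (induction w arbitrary: p)
  case (Cons x w)
  then have "outputs stay subst () w \<in> lists (tilde A)"
    "word_val G (outputs stay subst () w) = word_val G w" by auto
  then show ?case using Cons subst_spec[of x p] word_val_append[OF A(1) subst_spec(1)]
    by auto
qed simp

section \<open>Context-free subsets of \<open>G\<close> and their parts in the cosets of
  \<open>H\<close>\<close>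

definition part :: "'a set \<Rightarrow> 'a set \<Rightarrow> 'a set" where
  "part K C = {h \<in> H. h \<otimes> rep C \<in> K}"

text \<open>The trailing word in \<open>context_free_inverse_machine\<close> serves this lemma,
  where it spells the representative of \<open>C\<close>.\<close>

lemma CF_imp_part_CF:
  assumes K: "K \<in> CF G A" and C: "C \<in> rcosets H"
  shows "part K C \<in> CF GH B"
proof -
  let ?t = "word A (rep C)"
  have t: "?t \<in> lists (tilde A)" "word_val G ?t = rep C"
    using word_spec[OF A(1)] A(2) rep_closed[OF C] by auto
  have "context_free (tilde B) {w \<in> lists (tilde B). foldl stay () w = () \<and>
      outputs stay subst () w @ ?t \<in> full_preimage G A K}"
    using K by (intro context_free_inverse_machine[where Q = UNIV]) (auto simp: CF_def finite_tilde)
  also have "{w \<in> lists (tilde B). foldl stay () w = () \<and>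
      outputs stay subst () w @ ?t \<in> full_preimage G A K} = full_preimage GH B (part K C)"
  proof (rule Collect_cong[of _ "\<lambda>w. w \<in> lists (tilde B) \<and> word_val GH w \<in> part K C",
        folded full_preimage_def], rule conj_cong[OF refl])
    fix w assume w: "w \<in> lists (tilde B)"
    have "outputs stay subst () w @ ?t \<in> full_preimage G A K \<longleftrightarrow> word_val G w \<otimes> rep C \<in> K"
      using outputs_subst[OF w, of "()"] t word_val_append[OF A(1), of "outputs stay subst () w" ?t]
      by (auto simp: full_preimage_def simp del: in_lists_conv_set)
    then show "foldl stay () w = () \<and> outputs stay subst () w @ ?t \<in> full_preimage G A K \<longleftrightarrow>
        word_val GH w \<in> part K C"
      using word_val_subgroup[OF H B(1) w] word_val_H[OF w] by (simp add: part_def)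
  qed
  finally show ?thesis by (simp add: CF_def part_def subset_iff)
qed

lemma part_CF_imp_CF:
  assumes K: "K \<subseteq> carrier G" and parts: "\<And>C. C \<in> rcosets H \<Longrightarrow> part K C \<in> CF GH B"
  shows "K \<in> CF G A"
proof -
  have "context_free (tilde A) (\<Union>C\<in>rcosets H. {w \<in> lists (tilde A). foldl move H w = C \<and>
      outputs move rewrite H w @ [] \<in> full_preimage GH B (part K C)})"
    using parts H_coset move_in
    by (intro context_free_UN fin context_free_inverse_machine[where Q = "rcosets H"])
      (auto simp: CF_def finite_tilde fin)
  also have "(\<Union>C\<in>rcosets H. {w \<in> lists (tilde A). foldl move H w = C \<and>
      outputs move rewrite H w @ [] \<in> full_preimage GH B (part K C)}) = full_preimage G A K"
  proof -
    have "(\<exists>C\<in>rcosets H. foldl move H w = C \<and>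
        outputs move rewrite H w @ [] \<in> full_preimage GH B (part K C)) \<longleftrightarrow> word_val G w \<in> K"
      if w: "w \<in> lists (tilde A)" for w
    proof -
      let ?C = "foldl move H w" and ?u = "outputs move rewrite H w"
      have wG: "word_val G w \<in> carrier G" using word_val_closed[OF A(1) w] .
      have C: "?C \<in> rcosets H" using foldl_move[OF H_coset w] move_coset(1)[OF H_coset wG] by simp
      have u: "?u \<in> lists (tilde B)" using outputs_over[OF H_coset w] .
      \<comment> \<open>Rewriting loses exactly the representative of the final coset, and the final
        state remembers that coset.\<close>
      have "word_val G ?u \<otimes> rep ?C = word_val G w"
        using word_val_outputs[OF H_coset w] wG rep_closed[OF C] by (simp add: rep_H m_assoc)
      then have "?u \<in> full_preimage GH B (part K ?C) \<longleftrightarrow> word_val G w \<in> K"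
        using u word_val_subgroup[OF H B(1) u] word_val_H[OF u]
        by (simp add: full_preimage_def part_def del: in_lists_conv_set)
      then show ?thesis using C by auto
    qed
    then show ?thesis unfolding full_preimage_def[of G A K] by blast
  qed
  finally show ?thesis using K by (simp add: CF_def)
qed

text \<open>Any language with the given value set will do in place of the full preimage, since the
  final coset and the value of the output are functions of the value of \<open>w\<close>. This is
  why a grammar of \<open>L\<close> suffices as input of the reduction.\<close>

lemma part_image:
  assumes L: "L \<subseteq> lists (tilde A)" and C: "C \<in> rcosets H"
  shows "part (word_val G ` L) C = word_val GH ` {u. \<exists>w\<in>L.
    path (machine_edges move rewrite (rcosets H) (tilde A)) H w u C}"
proof -
  have path: "path (machine_edges move rewrite (rcosets H) (tilde A)) H w u C \<longleftrightarrow>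
      H #> word_val G w = C \<and> u = outputs move rewrite H w" if "w \<in> L" for w u
    using that L path_machine_edges_iff[of "rcosets H" "tilde A" move H rewrite w u C] move_in H_coset
      foldl_move[OF H_coset, of w] by auto
  have val: "word_val GH (outputs move rewrite H w) = word_val G w \<otimes> inv (rep C)"
    if "w \<in> L" "H #> word_val G w = C" for w
  proof -
    have w: "w \<in> lists (tilde A)" using that L by blast
    have "foldl move H w = C" using foldl_move[OF H_coset w] that by simp
    then show ?thesis
      using word_val_outputs[OF H_coset w] word_val_subgroup[OF H B(1) outputs_over[OF H_coset w]]
        word_val_closed[OF A(1) w] by (simp add: rep_H)
  qed
  show ?thesis
  proof (rule subset_antisym; rule subsetI)
    fix h assume "h \<in> part (word_val G ` L) C"
    then obtain w where w: "w \<in> L" "h \<in> H" "h \<otimes> rep C = word_val G w" by (auto simp: part_def)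
    have hG: "h \<in> carrier G" using w H_subset by blast
    have "H #> word_val G w = (H #> h) #> rep C"
      unfolding w(3)[symmetric] using coset_mult_assoc[OF H_subset hG rep_closed[OF C]] by simp
    also have "\<dots> = C" using coset_join2[OF hG H w(2)] coset_rep[OF C] by simp
    finally have c: "H #> word_val G w = C" .
    have "word_val GH (outputs move rewrite H w) = h"
      using val[OF w(1) c] w(3)[symmetric] hG rep_closed[OF C] by (simp add: m_assoc)
    then show "h \<in> word_val GH ` {u. \<exists>w\<in>L.
        path (machine_edges move rewrite (rcosets H) (tilde A)) H w u C}"
      using path[OF w(1)] c w(1) by blast
  next
    fix h assume "h \<in> word_val GH ` {u. \<exists>w\<in>L.
        path (machine_edges move rewrite (rcosets H) (tilde A)) H w u C}"
    then obtain w u where "w \<in> L" "h = word_val GH u"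
      "path (machine_edges move rewrite (rcosets H) (tilde A)) H w u C" by blast
    then have w: "w \<in> L" "H #> word_val G w = C" "h = word_val GH (outputs move rewrite H w)"
      using path[of w u] by simp_all
    then have h: "h = word_val G w \<otimes> inv (rep C)" using val by simp
    have wG: "word_val G w \<in> carrier G" using w L word_val_closed[OF A(1)] by blast
    have "h \<in> H" unfolding h using rep_quotient[OF wG C w(2)] .
    moreover have "h \<otimes> rep C = word_val G w" unfolding h using wG rep_closed[OF C] by (simp add: m_assoc)
    ultimately show "h \<in> part (word_val G ` L) C" using w by (auto simp: part_def)
  qed
qed

theorem CF_iff_rewritten:
  assumes "L \<subseteq> lists (tilde A)"
  shows "word_val G ` L \<in> CF G A \<longleftrightarrow> (\<forall>C\<in>rcosets H. word_val GH ` {u. \<exists>w\<in>L.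
    path (machine_edges move rewrite (rcosets H) (tilde A)) H w u C} \<in> CF GH B)"
proof -
  have "word_val G ` L \<subseteq> carrier G" using assms word_val_closed[OF A(1)] by blast
  then have "word_val G ` L \<in> CF G A \<longleftrightarrow> (\<forall>C\<in>rcosets H. part (word_val G ` L) C \<in> CF GH B)"
    using CF_imp_part_CF part_CF_imp_CF by blast
  then show ?thesis using part_image[OF assms] by simp
qed

theorem CF_iff_substituted:
  assumes "L \<subseteq> lists (tilde B)"
  shows "word_val GH ` L \<in> CF GH B \<longleftrightarrow> word_val G ` {u. \<exists>w\<in>L.
    path (machine_edges stay subst UNIV (tilde B)) () w u ()} \<in> CF G A"
proof -
  let ?K = "word_val GH ` L"
  have val: "word_val GH w = word_val G w" if "w \<in> L" for w
    using that assms word_val_subgroup[OF H B(1)] by blast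
  have "path (machine_edges stay subst UNIV (tilde B)) () w u () \<longleftrightarrow> u = outputs stay subst () w"
    if "w \<in> L" for w u
    using that assms path_machine_edges_iff[of UNIV "tilde B" stay "()" subst w u "()"] by auto
  then have "{u. \<exists>w\<in>L. path (machine_edges stay subst UNIV (tilde B)) () w u ()} =
      outputs stay subst () ` L" by auto
  moreover have "word_val G ` outputs stay subst () ` L = ?K"
    unfolding image_image using assms val outputs_subst by (intro image_cong refl) (simp add: subset_iff)
  ultimately have image: "word_val G ` {u. \<exists>w\<in>L.
    path (machine_edges stay subst UNIV (tilde B)) () w u ()} = ?K" by simp
  have KH: "?K \<subseteq> H" using assms word_val_H by (simp add: image_subset_iff val) blast
  have part: "part ?K C = (if C = H then ?K else {})" if C: "C \<in> rcosets H" for C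
  proof (cases "C = H")
    case True
    then show ?thesis using KH H_subset by (auto simp: part_def rep_H subset_iff)
  next
    case False
    have "h \<otimes> rep C \<notin> H" if "h \<in> H" for h
    proof
      assume "h \<otimes> rep C \<in> H"
      then have "inv h \<otimes> (h \<otimes> rep C) \<in> H"
        using that subgroup.m_closed[OF H] subgroup.m_inv_closed[OF H] by blast
      then have "rep C \<in> H"
        using that H_subset rep_closed[OF C] by (simp add: m_assoc[symmetric] subsetD)
      then have "H #> rep C = H" using coset_join2[OF rep_closed[OF C] H] by simp
      then show False using False coset_rep[OF C] by simp
    qed
    then show ?thesis using False KH by (auto simp: part_def)
  qed
  \<comment> \<open>The parts in cosets other than \<open>H\<close> are empty and must be
    context-free too; the empty language arises as a union over no index.\<close>
  have "context_free (tilde B) {}" using context_free_UN[of "{}"] by simp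
  then have empty: "{} \<in> CF GH B" by (simp add: CF_def full_preimage_def)
  have "?K \<in> CF GH B \<longleftrightarrow> (\<forall>C\<in>rcosets H. part ?K C \<in> CF GH B)"
    using part empty H_coset by auto
  also have "\<dots> \<longleftrightarrow> ?K \<in> CF G A"
    using CF_imp_part_CF part_CF_imp_CF KH H_subset by blast
  finally show ?thesis unfolding image .
qed

end

section \<open>Computability relative to an oracle\<close>

text \<open>Total functions of \<open>n\<close> arguments, given on the list of arguments as
  \<open>computes\<close> takes it. Only lists of length \<open>n\<close> count, so positions can be
  addressed freely by \<open>!\<close> and \<open>drop\<close>.\<close>

definition computable_in :: "nat set \<Rightarrow> nat \<Rightarrow> (nat list \<Rightarrow> nat) \<Rightarrow> bool" where
  "computable_in X n f \<longleftrightarrow> (\<exists>p. \<forall>xs. length xs = n \<longrightarrow> computes X p xs (f xs))"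

lemma computable_cong:
  assumes "computable_in X n f" "\<And>xs. length xs = n \<Longrightarrow> g xs = f xs"
  shows "computable_in X n g"
  using assms unfolding computable_in_def by metis

lemma computable_nth: "i < n \<Longrightarrow> computable_in X n (\<lambda>xs. xs ! i)"
  unfolding computable_in_def by (rule exI[of _ "Proj i"]) (auto intro: computes.intros)

lemma computable_comp:
  assumes f: "computable_in X (length gs) f" and gs: "\<And>g. g \<in> set gs \<Longrightarrow> computable_in X n g"
  shows "computable_in X n (\<lambda>xs. f (map (\<lambda>g. g xs) gs))"
proof -
  obtain p where p: "\<And>xs. length xs = length gs \<Longrightarrow> computes X p xs (f xs)"
    using f unfolding computable_in_def by blast
  obtain c where c: "\<And>g xs. g \<in> set gs \<Longrightarrow> length xs = n \<Longrightarrow> computes X (c g) xs (g xs)"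
    using gs unfolding computable_in_def by metis
  have "computes X (Comp p (map c gs)) xs (f (map (\<lambda>g. g xs) gs))" if "length xs = n" for xs
  proof (rule computes.intros)
    show "list_all2 (\<lambda>q y. computes X q xs y) (map c gs) (map (\<lambda>g. g xs) gs)"
      using c that by (simp add: list_all2_conv_all_nth)
    show "computes X p (map (\<lambda>g. g xs) gs) (f (map (\<lambda>g. g xs) gs))" using p by simp
  qed
  then show ?thesis unfolding computable_in_def by blast
qed

lemma computable_app1:
  "computable_in X 1 (\<lambda>xs. F (xs ! 0)) \<Longrightarrow> computable_in X n f \<Longrightarrow> computable_in X n (\<lambda>xs. F (f xs))"
  using computable_comp[of X "[f]" "\<lambda>xs. F (xs ! 0)" n] by simp

lemma computable_app2:
  "computable_in X 2 (\<lambda>xs. F (xs ! 0) (xs ! 1)) \<Longrightarrow> computable_in X n f \<Longrightarrow> computable_in X n g \<Longrightarrow>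
    computable_in X n (\<lambda>xs. F (f xs) (g xs))"
  using computable_comp[of X "[f, g]" "\<lambda>xs. F (xs ! 0) (xs ! 1)" n]
  by (auto simp: numeral_2_eq_2)

lemma computable_app3:
  "computable_in X 3 (\<lambda>xs. F (xs ! 0) (xs ! 1) (xs ! 2)) \<Longrightarrow>
    computable_in X n f \<Longrightarrow> computable_in X n g \<Longrightarrow> computable_in X n h \<Longrightarrow>
    computable_in X n (\<lambda>xs. F (f xs) (g xs) (h xs))"
  using computable_comp[of X "[f, g, h]" "\<lambda>xs. F (xs ! 0) (xs ! 1) (xs ! 2)" n]
  by (auto simp: numeral_2_eq_2 numeral_3_eq_3)

lemma computable_Suc: "computable_in X n f \<Longrightarrow> computable_in X n (\<lambda>xs. Suc (f xs))"
proof (rule computable_app1[where F = Suc])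
  have "computes X Succ xs (Suc (xs ! 0))" if "length xs = 1" for xs
    using that computes.intros(2)[of X "xs ! 0"] by (cases xs) auto
  then show "computable_in X 1 (\<lambda>xs. Suc (xs ! 0))" unfolding computable_in_def by blast
qed

lemma computable_const: "computable_in X n (\<lambda>_. c)"
proof (induction c)
  case 0
  show ?case unfolding computable_in_def by (rule exI[of _ Zero]) (auto intro: computes.intros)
qed (rule computable_Suc)

lemma computable_query: "computable_in X n f \<Longrightarrow> computable_in X n (\<lambda>xs. if f xs \<in> X then 1 else 0)"
proof (rule computable_app1[where F = "\<lambda>x. if x \<in> X then 1 else 0"])
  have "computes X Query xs (if xs ! 0 \<in> X then 1 else 0)" if "length xs = 1" for xs
    using that computes.intros(4)[of X "xs ! 0"] by (cases xs) auto
  then show "computable_in X 1 (\<lambda>xs. if xs ! 0 \<in> X then 1 else 0)" unfolding computable_in_def by blast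
qed

lemma computable_shift:
  assumes f: "computable_in X n f"
  shows "computable_in X (n + m) (\<lambda>xs. f (drop m xs))"
proof -
  let ?gs = "map (\<lambda>i xs. xs ! (i + m)) [0..<n] :: (nat list \<Rightarrow> nat) list"
  have "computable_in X (n + m) (\<lambda>xs. f (map (\<lambda>g. g xs) ?gs))"
    using f by (intro computable_comp) (auto intro: computable_nth)
  then show ?thesis
    by (rule computable_cong) (auto simp: comp_def add.commute intro!: arg_cong[of _ _ f] nth_equalityI)
qed

text \<open>The step function receives the counter and the previous value in front of the
  parameters, in the order in which \<open>PrimRec\<close> passes them.\<close>

lemma computable_rec:
  assumes g: "computable_in X n g" and b: "computable_in X n b"
    and s: "computable_in X (Suc (Suc n)) (\<lambda>ys. s (ys ! 0) (ys ! 1) (drop 2 ys))"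
  shows "computable_in X n (\<lambda>xs. rec_nat (b xs) (\<lambda>k r. s k r xs) (g xs))"
proof -
  obtain p where p: "\<And>xs. length xs = n \<Longrightarrow> computes X p xs (b xs)"
    using b unfolding computable_in_def by blast
  obtain q where q: "\<And>xs. length xs = Suc (Suc n) \<Longrightarrow>
      computes X q xs (s (xs ! 0) (xs ! 1) (drop 2 xs))"
    using s unfolding computable_in_def by blast
  have "computes X (PrimRec p q) (k # xs) (rec_nat (b xs) (\<lambda>k r. s k r xs) k)" if "length xs = n" for k xs
  proof (induction k)
    case 0
    then show ?case using p that by (auto intro: computes.intros)
  next
    case (Suc k)
    have "computes X q (k # rec_nat (b xs) (\<lambda>k r. s k r xs) k # xs)
        (s k (rec_nat (b xs) (\<lambda>k r. s k r xs) k) xs)"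
      using q[of "k # rec_nat (b xs) (\<lambda>k r. s k r xs) k # xs"] that by (simp add: numeral_2_eq_2)
    then show ?case using computes.intros(7)[OF Suc.IH] by simp
  qed
  then have *: "computable_in X (Suc n) (\<lambda>ys. rec_nat (b (tl ys)) (\<lambda>k r. s k r (tl ys)) (hd ys))"
    unfolding computable_in_def by (intro exI[of _ "PrimRec p q"]) (auto simp: length_Suc_conv)
  \<comment> \<open>\<open>PrimRec\<close> recurses on its first argument; composition with
    \<open>g\<close> and all projections puts the recursion bound there.\<close>
  let ?gs = "g # map (\<lambda>i xs. xs ! i) [0..<n]"
  have "map (\<lambda>i. xs ! i) [0..<n] = xs" if "length xs = n" for xs :: "nat list"
    using that map_nth by blast
  moreover have "computable_in X n (\<lambda>xs. (\<lambda>ys. rec_nat (b (tl ys)) (\<lambda>k r. s k r (tl ys)) (hd ys))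
      (map (\<lambda>g. g xs) ?gs))"
    using * g by (intro computable_comp) (auto intro: computable_nth)
  ultimately show ?thesis by (auto simp: comp_def intro: computable_cong)
qed

section \<open>Arithmetic and pairing by primitive recursion\<close>

lemmas computable_basic = computable_nth computable_Suc computable_const

lemma computable_add: "computable_in X n f \<Longrightarrow> computable_in X n g \<Longrightarrow> computable_in X n (\<lambda>xs. f xs + g xs)"
proof (rule computable_app2[where F = "(+)"])
  have "rec_nat y (\<lambda>k r. Suc r) x = x + y" for x y :: nat by (induction x) auto
  then show "computable_in X 2 (\<lambda>xs. xs ! 0 + xs ! 1)"
    using computable_rec[of X 2 "\<lambda>xs. xs ! 0" "\<lambda>xs. xs ! 1" "\<lambda>k r xs. Suc r"]
    by (simp add: computable_basic)
qed

lemma computable_pred: "computable_in X n f \<Longrightarrow> computable_in X n (\<lambda>xs. f xs - 1)"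
proof (rule computable_app1[where F = "\<lambda>x. x - 1"])
  have "rec_nat 0 (\<lambda>k r. k) x = x - 1" for x :: nat by (induction x) auto
  then show "computable_in X 1 (\<lambda>xs. xs ! 0 - 1)"
    using computable_rec[of X 1 "\<lambda>xs. xs ! 0" "\<lambda>xs. 0" "\<lambda>k r xs. k"]
    by (simp add: computable_basic)
qed

lemma computable_diff: "computable_in X n f \<Longrightarrow> computable_in X n g \<Longrightarrow> computable_in X n (\<lambda>xs. f xs - g xs)"
proof (rule computable_app2[where F = "(-)"])
  have "rec_nat x (\<lambda>k r. r - 1) y = x - y" for x y :: nat by (induction y) auto
  then show "computable_in X 2 (\<lambda>xs. xs ! 0 - xs ! 1)"
    using computable_rec[of X 2 "\<lambda>xs. xs ! 1" "\<lambda>xs. xs ! 0" "\<lambda>k r xs. r - 1"]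
    by (simp add: computable_basic computable_pred[simplified])
qed

lemma computable_if_zero:
  "computable_in X n f \<Longrightarrow> computable_in X n g \<Longrightarrow> computable_in X n h \<Longrightarrow>
    computable_in X n (\<lambda>xs. if f xs = 0 then g xs else h xs)"
proof (rule computable_app3[where F = "\<lambda>x y z. if x = 0 then y else z"])
  have "rec_nat y (\<lambda>k r. z) x = (if x = 0 then y else z)" for x y z :: nat by (cases x) auto
  then show "computable_in X 3 (\<lambda>xs. if xs ! 0 = 0 then xs ! 1 else xs ! 2)"
    using computable_rec[of X 3 "\<lambda>xs. xs ! 0" "\<lambda>xs. xs ! 1" "\<lambda>k r xs. xs ! 2"]
    using computable_shift[of X 3 "\<lambda>xs. xs ! 2" 2] by (simp add: computable_basic del: One_nat_def)
qed

lemma computable_triangle: "computable_in X n f \<Longrightarrow> computable_in X n (\<lambda>xs. triangle (f xs))"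
proof (rule computable_app1[where F = triangle])
  have "rec_nat 0 (\<lambda>k r. r + Suc k) x = triangle x" for x :: nat
    by (induction x) (simp_all add: triangle_Suc)
  then show "computable_in X 1 (\<lambda>xs. triangle (xs ! 0))"
    using computable_rec[of X 1 "\<lambda>xs. xs ! 0" "\<lambda>xs. 0" "\<lambda>k r xs. r + Suc k"]
    by (simp add: computable_basic computable_add del: add_Suc_right)
qed

lemma computable_prod_encode:
  "computable_in X n f \<Longrightarrow> computable_in X n g \<Longrightarrow> computable_in X n (\<lambda>xs. prod_encode (f xs, g xs))"
  unfolding prod_encode_def by (simp add: computable_triangle computable_add)

text \<open>The index of the diagonal of the Cantor pairing on which \<open>z\<close> lies.\<close>

definition diagonal :: "nat \<Rightarrow> nat" where
  "diagonal = rec_nat 0 (\<lambda>z d. if triangle (Suc d) - Suc z = 0 then Suc d else d)"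

text \<open>Truncated subtraction expresses, as a test for zero, that \<open>Suc z\<close> has
  reached the next triangular number. One increment of the diagonal is enough for each increment of
  \<open>z\<close>, as consecutive triangular numbers beyond it lie further apart.\<close>

lemma diagonal: "triangle (diagonal z) \<le> z \<and> z < triangle (Suc (diagonal z))"
  by (induction z) (auto simp: diagonal_def triangle_Suc)

text \<open>\<open>prod_encode (m, k)\<close> is \<open>triangle (m + k) + m\<close>: the diagonal
  is the sum of the components and the offset on it is the first one. This replaces the search in
  \<open>prod_decode\<close> by primitive recursion.\<close>

lemma prod_decode_diagonal:
  "prod_decode z = (z - triangle (diagonal z), diagonal z - (z - triangle (diagonal z)))"
proof -
  have "z - triangle (diagonal z) \<le> diagonal z" using diagonal[of z] by (auto simp: triangle_Suc)
  then have "prod_encode (z - triangle (diagonal z), diagonal z - (z - triangle (diagonal z))) = z"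
    using diagonal[of z] by (simp add: prod_encode_def)
  then show ?thesis by (metis prod_encode_inverse)
qed

lemma computable_prod_decode:
  assumes "computable_in X n f"
  shows "computable_in X n (\<lambda>xs. fst (prod_decode (f xs)))"
    "computable_in X n (\<lambda>xs. snd (prod_decode (f xs)))"
proof -
  have "computable_in X 1 (\<lambda>xs. diagonal (xs ! 0))"
    unfolding diagonal_def
    by (rule computable_rec[where s = "\<lambda>k r xs. if triangle (Suc r) - Suc k = 0 then Suc r else r"])
      (simp_all only: computable_basic computable_if_zero computable_diff computable_triangle
        one_less_numeral_iff zero_less_Suc less_numeral_extra Suc_less_eq One_nat_def)
  then have d: "computable_in X n (\<lambda>xs. diagonal (f xs))" using assms by (rule computable_app1)
  show "computable_in X n (\<lambda>xs. fst (prod_decode (f xs)))"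
    "computable_in X n (\<lambda>xs. snd (prod_decode (f xs)))"
    unfolding prod_decode_diagonal by (simp_all add: assms d computable_diff computable_triangle)
qed

lemma computable_mod2: "computable_in X n f \<Longrightarrow> computable_in X n (\<lambda>xs. f xs mod 2)"
proof (rule computable_app1[where F = "\<lambda>x. x mod 2"])
  have "rec_nat 0 (\<lambda>k r. 1 - r) x = x mod 2" for x :: nat by (induction x) (auto simp: mod_Suc)
  then show "computable_in X 1 (\<lambda>xs. xs ! 0 mod 2)"
    using computable_rec[of X 1 "\<lambda>xs. xs ! 0" "\<lambda>xs. 0" "\<lambda>k r xs. 1 - r"]
    by (simp add: computable_basic computable_diff)
qed

section \<open>Predicates decidable with the oracle\<close>

definition decidable_in :: "nat set \<Rightarrow> nat \<Rightarrow> (nat list \<Rightarrow> bool) \<Rightarrow> bool" where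
  "decidable_in X n P \<longleftrightarrow> computable_in X n (\<lambda>xs. if P xs then 1 else 0)"

lemma decidable_zero: "computable_in X n f \<Longrightarrow> decidable_in X n (\<lambda>xs. f xs = 0)"
  unfolding decidable_in_def by (intro computable_if_zero computable_const)

lemma decidable_eq:
  assumes "computable_in X n f" "computable_in X n g"
  shows "decidable_in X n (\<lambda>xs. f xs = g xs)"
proof -
  have "decidable_in X n (\<lambda>xs. (f xs - g xs) + (g xs - f xs) = 0)"
    using assms by (intro decidable_zero computable_add computable_diff)
  moreover have "(f xs - g xs) + (g xs - f xs) = 0 \<longleftrightarrow> f xs = g xs" for xs by auto
  ultimately show ?thesis by simp
qed

lemma computable_if:
  assumes "decidable_in X n P" "computable_in X n f" "computable_in X n g"
  shows "computable_in X n (\<lambda>xs. if P xs then f xs else g xs)"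
  using computable_if_zero[OF assms(1)[unfolded decidable_in_def] assms(3,2)]
  by (rule computable_cong) auto

lemma decidable_not: "decidable_in X n P \<Longrightarrow> decidable_in X n (\<lambda>xs. \<not> P xs)"
  using computable_if[of X n P "\<lambda>_. 0" "\<lambda>_. 1"] computable_const
  unfolding decidable_in_def by (auto intro: computable_cong)

lemma decidable_conj:
  "decidable_in X n P \<Longrightarrow> decidable_in X n Q \<Longrightarrow> decidable_in X n (\<lambda>xs. P xs \<and> Q xs)"
  using computable_if[of X n P "\<lambda>xs. if Q xs then 1 else 0" "\<lambda>_. 0"] computable_const
  unfolding decidable_in_def by (auto intro: computable_cong)

lemma decidable_disj:
  "decidable_in X n P \<Longrightarrow> decidable_in X n Q \<Longrightarrow> decidable_in X n (\<lambda>xs. P xs \<or> Q xs)"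
  using decidable_not[OF decidable_conj[OF decidable_not decidable_not]] by fastforce

lemma decidable_ball:
  "finite I \<Longrightarrow> (\<And>i. i \<in> I \<Longrightarrow> decidable_in X n (P i)) \<Longrightarrow> decidable_in X n (\<lambda>xs. \<forall>i\<in>I. P i xs)"
proof (induction rule: finite_induct)
  case empty
  then show ?case by (simp add: decidable_in_def computable_const)
next
  case (insert i I)
  then show ?case using decidable_conj[of X n "P i" "\<lambda>xs. \<forall>i\<in>I. P i xs"] by simp
qed

lemma decidable_bex:
  "finite I \<Longrightarrow> (\<And>i. i \<in> I \<Longrightarrow> decidable_in X n (P i)) \<Longrightarrow> decidable_in X n (\<lambda>xs. \<exists>i\<in>I. P i xs)"
  using decidable_not[OF decidable_ball[of I X n "\<lambda>i xs. \<not> P i xs"]] decidable_not by simp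

lemma decidable_query: "computable_in X n f \<Longrightarrow> decidable_in X n (\<lambda>xs. f xs \<in> X)"
  unfolding decidable_in_def by (rule computable_query)

lemma turing_reducible_if_decidable: "decidable_in X 1 (\<lambda>xs. xs ! 0 \<in> P) \<Longrightarrow> P \<le>\<^sub>T X"
  unfolding decidable_in_def computable_in_def turing_reducible_def
  by (metis One_nat_def length_Cons list.size(3) nth_Cons_0)

section \<open>Lists coded as numbers\<close>

lemma list_decode_nonzero:
  "c \<noteq> 0 \<Longrightarrow> list_decode c = fst (prod_decode (c - 1)) # list_decode (snd (prod_decode (c - 1)))"
  by (cases c) (auto split: prod.splits)

text \<open>A nonempty list has as code the successor of the pair of its head and coded tail, and 0
  codes the empty list. At 0, head and tail both evaluate to 0, so that dropping beyond the end
  stays at the empty list.\<close>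

definition code_hd :: "nat \<Rightarrow> nat" where "code_hd c = fst (prod_decode (c - 1))"
definition code_tl :: "nat \<Rightarrow> nat" where "code_tl c = snd (prod_decode (c - 1))"
definition code_cons :: "nat \<Rightarrow> nat \<Rightarrow> nat" where "code_cons x c = Suc (prod_encode (x, c))"
definition code_drop :: "nat \<Rightarrow> nat \<Rightarrow> nat" where "code_drop j c = rec_nat c (\<lambda>_ r. code_tl r) j"

lemma list_encode_Cons: "list_encode (x # xs) = code_cons x (list_encode xs)"
  by (simp add: code_cons_def)

lemma list_decode_cons: "list_decode (code_cons x c) = x # list_decode c"
  by (simp add: code_cons_def)

lemma code_hd_tl_cons [simp]: "code_hd (code_cons x c) = x" "code_tl (code_cons x c) = c"
  by (simp_all add: code_hd_def code_tl_def code_cons_def)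

lemma list_decode_tl: "list_decode (code_tl c) = tl (list_decode c)"
proof (cases "c = 0")
  case True
  have "prod_decode 0 = (0, 0)" using prod_encode_inverse[of "(0, 0)"] by (simp add: prod_encode_def)
  then show ?thesis using True by (simp add: code_tl_def)
qed (simp add: list_decode_nonzero code_tl_def)

lemma list_decode_drop: "list_decode (code_drop j c) = drop j (list_decode c)"
  by (induction j) (simp_all add: code_drop_def list_decode_tl drop_Suc tl_drop)

lemma code_drop: "code_drop j c = list_encode (drop j (list_decode c))"
  using list_decode_drop by (metis list_decode_inverse)

lemma list_decode_eq_Nil: "list_decode c = [] \<longleftrightarrow> c = 0"
  using list_decode_nonzero by (cases "c = 0") auto

text \<open>Makes the code itself a computable bound for loops over the positions of the
  list.\<close>

lemma length_list_decode: "length (list_decode c) \<le> c"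
proof -
  have "length xs \<le> list_encode xs" for xs
  proof (induction xs)
    case (Cons x xs)
    then show ?case using le_prod_encode_2[of "list_encode xs" x] by simp
  qed simp
  then show ?thesis by (metis list_decode_inverse)
qed

lemma computable_cons:
  "computable_in X n f \<Longrightarrow> computable_in X n g \<Longrightarrow> computable_in X n (\<lambda>xs. code_cons (f xs) (g xs))"
  unfolding code_cons_def by (intro computable_Suc computable_prod_encode)

lemma computable_hd: "computable_in X n f \<Longrightarrow> computable_in X n (\<lambda>xs. code_hd (f xs))"
  unfolding code_hd_def by (intro computable_prod_decode computable_pred)

lemma computable_tl: "computable_in X n f \<Longrightarrow> computable_in X n (\<lambda>xs. code_tl (f xs))"
  unfolding code_tl_def by (intro computable_prod_decode computable_pred)

lemma computable_drop:
  "computable_in X n f \<Longrightarrow> computable_in X n g \<Longrightarrow> computable_in X n (\<lambda>xs. code_drop (f xs) (g xs))"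
  unfolding code_drop_def
  by (rule computable_rec[where s = "\<lambda>k r xs. code_tl r"]) (auto intro: computable_tl computable_nth)

subsection \<open>Computably listed finite sets\<close>

text \<open>
  The codes of lists are used up to the order and multiplicity of the entries. The program receives
  an accumulator as first argument, which makes unions a matter of composition.
\<close>

definition emits :: "nat set \<Rightarrow> nat \<Rightarrow> (nat list \<Rightarrow> nat set) \<Rightarrow> bool" where
  "emits X n S \<longleftrightarrow> (\<exists>f. computable_in X (Suc n) f \<and>
    (\<forall>a xs. length xs = n \<longrightarrow> set (list_decode (f (a # xs))) = set (list_decode a) \<union> S xs))"

lemma emitsE:
  assumes "emits X n S"
  obtains f where "computable_in X (Suc n) f"
    "\<forall>a xs. length xs = n \<longrightarrow> set (list_decode (f (a # xs))) = set (list_decode a) \<union> S xs"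
  using assms unfolding emits_def by blast

lemma emitsI:
  assumes "computable_in X (Suc n) f"
    "\<And>a xs. length xs = n \<Longrightarrow> set (list_decode (f (a # xs))) = set (list_decode a) \<union> S xs"
  shows "emits X n S"
  using assms unfolding emits_def by blast

text \<open>Puts a computed value in place of the first \<open>m\<close> arguments:
  \<open>m = 1\<close> threads an accumulator through a call, \<open>m = 0\<close> supplies an
  initial one.\<close>

lemma computable_Cons:
  assumes f: "computable_in X (Suc n) f" and a: "computable_in X (n + m) a"
  shows "computable_in X (n + m) (\<lambda>xs. f (a xs # drop m xs))"
proof -
  let ?gs = "a # map (\<lambda>i xs. xs ! (i + m)) [0..<n] :: (nat list \<Rightarrow> nat) list"
  have "computable_in X (n + m) (\<lambda>xs. f (map (\<lambda>g. g xs) ?gs))"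
    using f a by (intro computable_comp) (auto intro: computable_nth)
  moreover have "map (\<lambda>i. xs ! (i + m)) [0..<n] = drop m xs" if "length xs = n + m" for xs :: "nat list"
    using that by (intro nth_equalityI) (auto simp: add.commute)
  ultimately show ?thesis by (elim computable_cong) (simp add: comp_def)
qed

lemma computable_list:
  assumes "emits X n S"
  obtains f where "computable_in X n f" "\<forall>xs. length xs = n \<longrightarrow> set (list_decode (f xs)) = S xs"
proof -
  obtain f where f: "computable_in X (Suc n) f"
    "\<forall>a xs. length xs = n \<longrightarrow> set (list_decode (f (a # xs))) = set (list_decode a) \<union> S xs"
    using assms by (rule emitsE)
  have "computable_in X n (\<lambda>xs. f (0 # xs))"
    using computable_Cons[OF f(1), of 0 "\<lambda>_. 0"] computable_const by simp
  then show thesis using that f(2) by simp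
qed

lemma emits_empty: "emits X n (\<lambda>_. {})"
  by (rule emitsI[of _ _ "\<lambda>ys. ys ! 0"]) (auto intro: computable_nth)

lemma emits_insert:
  assumes "computable_in X n e"
  shows "emits X n (\<lambda>xs. {e xs})"
proof (rule emitsI)
  show "computable_in X (Suc n) (\<lambda>ys. code_cons (e (drop 1 ys)) (ys ! 0))"
    using computable_shift[OF assms, of 1] by (intro computable_cons computable_nth) auto
qed (simp add: list_decode_cons)

lemma emits_Un:
  assumes "emits X n S" "emits X n T"
  shows "emits X n (\<lambda>xs. S xs \<union> T xs)"
proof -
  obtain f where f: "computable_in X (Suc n) f"
    "\<forall>a xs. length xs = n \<longrightarrow> set (list_decode (f (a # xs))) = set (list_decode a) \<union> S xs"
    using assms(1) by (rule emitsE)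
  obtain g where g: "computable_in X (Suc n) g"
    "\<forall>a xs. length xs = n \<longrightarrow> set (list_decode (g (a # xs))) = set (list_decode a) \<union> T xs"
    using assms(2) by (rule emitsE)
  show ?thesis
  proof (rule emitsI)
    show "computable_in X (Suc n) (\<lambda>ys. g (f ys # drop 1 ys))"
      using computable_Cons[OF g(1), of 1 f] f(1) by simp
  qed (use f g in auto)
qed

lemma emits_if:
  assumes P: "decidable_in X n P" and "emits X n S" "emits X n T"
  shows "emits X n (\<lambda>xs. if P xs then S xs else T xs)"
proof -
  obtain f where f: "computable_in X (Suc n) f"
    "\<forall>a xs. length xs = n \<longrightarrow> set (list_decode (f (a # xs))) = set (list_decode a) \<union> S xs"
    using assms(2) by (rule emitsE)
  obtain g where g: "computable_in X (Suc n) g"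
    "\<forall>a xs. length xs = n \<longrightarrow> set (list_decode (g (a # xs))) = set (list_decode a) \<union> T xs"
    using assms(3) by (rule emitsE)
  have "decidable_in X (Suc n) (\<lambda>ys. P (drop 1 ys))"
    using computable_shift[OF P[unfolded decidable_in_def], of 1] by (simp add: decidable_in_def)
  then show ?thesis
    by (rule emitsI[OF computable_if[OF _ f(1) g(1)]]) (use f g in auto)
qed

text \<open>A bounded loop: the value carried by the recursion is the accumulator, to which round
  \<open>k\<close> adds the members of its set.\<close>

lemma emits_UN_less:
  assumes b: "computable_in X n b" and S: "emits X (Suc n) (\<lambda>xs. S (xs ! 0) (drop 1 xs))"
  shows "emits X n (\<lambda>xs. \<Union>k<b xs. S k xs)"
proof -
  obtain f where f: "computable_in X (Suc (Suc n)) f"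
    "\<forall>a xs. length xs = Suc n \<longrightarrow>
      set (list_decode (f (a # xs))) = set (list_decode a) \<union> S (xs ! 0) (drop 1 xs)"
    using S by (rule emitsE)
  define F where "F = (\<lambda>ys. rec_nat (ys ! 0) (\<lambda>k r. f (r # k # drop 1 ys)) (b (drop 1 ys)))"
  show ?thesis
  proof (rule emitsI)
    show "computable_in X (Suc n) F"
      unfolding F_def
    proof (rule computable_rec[where s = "\<lambda>k r ys. f (r # k # drop 1 ys)"])
      show "computable_in X (Suc n) (\<lambda>ys. b (drop 1 ys))" using computable_shift[OF b, of 1] by simp
      show "computable_in X (Suc n) (\<lambda>ys. ys ! 0)" by (simp add: computable_nth)
      \<comment> \<open>The recursion supplies counter, carried value, initial accumulator and
        parameters, whereas \<open>f\<close> expects carried value, counter and parameters; hence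
        the swap and the offset 3.\<close>
      let ?gs = "(\<lambda>xs. xs ! 1) # (\<lambda>xs. xs ! 0) # map (\<lambda>i xs. xs ! (i + 3)) [0..<n] :: (nat list \<Rightarrow> nat) list"
      have "computable_in X (Suc (Suc (Suc n))) (\<lambda>xs. f (map (\<lambda>g. g xs) ?gs))"
        using f(1) by (intro computable_comp) (auto intro: computable_nth)
      moreover have "map (\<lambda>i. xs ! (i + 3)) [0..<n] = drop 1 (drop 2 xs)"
        if "length xs = Suc (Suc (Suc n))" for xs :: "nat list"
        using that by (intro nth_equalityI) (auto simp: add.commute eval_nat_numeral)
      ultimately show "computable_in X (Suc (Suc (Suc n))) (\<lambda>ys. f (ys ! 1 # ys ! 0 # drop 1 (drop 2 ys)))"
        by (elim computable_cong) (simp add: comp_def)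
    qed
  next
    fix a and xs :: "nat list" assume xs: "length xs = n"
    have "set (list_decode (rec_nat a (\<lambda>k r. f (r # k # xs)) m)) =
        set (list_decode a) \<union> (\<Union>k<m. S k xs)" for m
      using xs by (induction m) (auto simp: f(2) lessThan_Suc)
    then show "set (list_decode (F (a # xs))) = set (list_decode a) \<union> (\<Union>k<b xs. S k xs)"
      by (simp add: F_def)
  qed
qed

lemma emits_UN_finite:
  assumes "finite I" "\<And>i. i \<in> I \<Longrightarrow> emits X n (S i)"
  shows "emits X n (\<lambda>xs. \<Union>i\<in>I. S i xs)"
  using assms
proof (induction rule: finite_induct)
  case (insert i I)
  then show ?case using emits_Un[of X n "S i" "\<lambda>xs. \<Union>i\<in>I. S i xs"] by simp
qed (simp add: emits_empty)

lemma emits_cong: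
  "emits X n S \<Longrightarrow> (\<And>xs. length xs = n \<Longrightarrow> T xs = S xs) \<Longrightarrow> emits X n T"
  unfolding emits_def by metis

lemma emits_subst_hd:
  assumes S: "emits X (Suc n) (\<lambda>xs. S (xs ! 0) (drop 1 xs))" and h: "computable_in X (Suc n) h"
  shows "emits X (Suc n) (\<lambda>xs. S (h xs) (drop 1 xs))"
proof -
  obtain f where f: "computable_in X (Suc (Suc n)) f"
    "\<forall>a xs. length xs = Suc n \<longrightarrow>
      set (list_decode (f (a # xs))) = set (list_decode a) \<union> S (xs ! 0) (drop 1 xs)"
    using S by (rule emitsE)
  show ?thesis
  proof (rule emitsI)
    let ?gs = "(\<lambda>xs. xs ! 0) # (\<lambda>xs. h (drop 1 xs)) # map (\<lambda>i xs. xs ! (i + 2)) [0..<n] :: (nat list \<Rightarrow> nat) list"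
    have "computable_in X (Suc (Suc n)) (\<lambda>xs. h (drop 1 xs))" using computable_shift[OF h, of 1] by simp
    then have "computable_in X (Suc (Suc n)) (\<lambda>xs. f (map (\<lambda>g. g xs) ?gs))"
      using f(1) by (intro computable_comp) (auto intro: computable_nth)
    moreover have "map (\<lambda>i. xs ! (i + 2)) [0..<n] = drop 1 (drop 1 xs)"
      if "length xs = Suc (Suc n)" for xs :: "nat list"
      using that by (intro nth_equalityI) (auto simp: add.commute)
    ultimately show "computable_in X (Suc (Suc n)) (\<lambda>ys. f (ys ! 0 # h (drop 1 ys) # drop 1 (drop 1 ys)))"
      by (elim computable_cong) (simp add: comp_def)
  qed (use f(2) in auto)
qed

text \<open>Beyond the length of the list every suffix is empty, and the code \<open>l xs\<close>
  bounds that length; so a loop up to and including \<open>l xs\<close> meets every suffix.\<close>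

lemma emits_UN_suffixes:
  assumes l: "computable_in X n l" and S: "emits X (Suc n) (\<lambda>xs. S (xs ! 0) (drop 1 xs))"
  shows "emits X n (\<lambda>xs. \<Union>j. S (code_drop j (l xs)) xs)"
proof -
  have "computable_in X (Suc n) (\<lambda>xs. code_drop (xs ! 0) (l (drop 1 xs)))"
    using computable_shift[OF l, of 1] by (intro computable_drop computable_nth) auto
  from emits_subst_hd[OF S this]
  have "emits X n (\<lambda>xs. \<Union>j<Suc (l xs). S (code_drop j (l xs)) xs)"
    by (intro emits_UN_less computable_Suc l)
  then show ?thesis
  proof (rule emits_cong)
    fix xs
    have "\<exists>i<Suc (l xs). code_drop j (l xs) = code_drop i (l xs)" for j
    proof (cases "j < Suc (l xs)")
      case False
      then show ?thesis
        using length_list_decode[of "l xs"] by (intro exI[of _ "l xs"]) (simp add: code_drop)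
    qed blast
    then show "(\<Union>j. S (code_drop j (l xs)) xs) = (\<Union>j<Suc (l xs). S (code_drop j (l xs)) xs)"
      by (simp add: set_eq_iff Bex_def) metis
  qed
qed

text \<open>The entries of a list are the heads of its nonempty suffixes, so this is a loop over
  suffixes that skips the empty one.\<close>

lemma emits_UN_list:
  assumes l: "computable_in X n l" and S: "emits X (Suc n) (\<lambda>xs. S (xs ! 0) (drop 1 xs))"
  shows "emits X n (\<lambda>xs. \<Union>x\<in>set (list_decode (l xs)). S x xs)"
proof -
  have hd: "computable_in X (Suc n) (\<lambda>xs. code_hd (xs ! 0))" by (intro computable_hd computable_nth) simp
  have "emits X (Suc n) (\<lambda>xs. if xs ! 0 = 0 then {} else S (code_hd (xs ! 0)) (drop 1 xs))"
    using decidable_zero[OF computable_nth[of 0 "Suc n"]] emits_empty emits_subst_hd[OF S hd]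
    by (rule emits_if) simp
  from emits_UN_suffixes[OF l, of "\<lambda>c xs. if c = 0 then {} else S (code_hd c) xs", OF this]
  have "emits X n (\<lambda>xs. \<Union>j. (\<lambda>c xs. if c = 0 then {} else S (code_hd c) xs) (code_drop j (l xs)) xs)" .
  then show ?thesis
  proof (rule emits_cong)
    fix xs
    have "x \<in> set (list_decode c) \<longleftrightarrow> (\<exists>j. code_drop j c \<noteq> 0 \<and> x = code_hd (code_drop j c))" for x c
    proof -
      have "code_hd (code_drop j c) = list_decode c ! j" if "j < length (list_decode c)" for j
        using that by (simp add: code_drop Cons_nth_drop_Suc[symmetric] list_encode_Cons del: list_encode.simps)
      moreover have "code_drop j c \<noteq> 0 \<longleftrightarrow> j < length (list_decode c)" for j
        using list_decode_eq_Nil[of "code_drop j c"] by (auto simp: list_decode_drop)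
      ultimately show ?thesis by (metis in_set_conv_nth)
    qed
    then show "(\<Union>x\<in>set (list_decode (l xs)). S x xs) =
        (\<Union>j. (\<lambda>c xs. if c = 0 then {} else S (code_hd c) xs) (code_drop j (l xs)) xs)"
      by (auto split: if_splits)
  qed
qed

text \<open>The program emits a dummy entry for each counterexample; there is none if and only if
  the emitted list is empty, that is, its code is 0.\<close>

lemma decidable_ball_list:
  assumes l: "computable_in X n l" and P: "decidable_in X (Suc n) (\<lambda>xs. P (xs ! 0) (drop 1 xs))"
  shows "decidable_in X n (\<lambda>xs. \<forall>x\<in>set (list_decode (l xs)). P x xs)"
proof -
  have "emits X n (\<lambda>xs. \<Union>x\<in>set (list_decode (l xs)). if P x xs then {} else {0})"
    using emits_UN_list[OF l, of "\<lambda>x xs. if P x xs then {} else {0}",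
        OF emits_if[OF P emits_empty emits_insert[OF computable_const]]] .
  then obtain f where f: "computable_in X n f"
    "\<forall>xs. length xs = n \<longrightarrow>
      set (list_decode (f xs)) = (\<Union>x\<in>set (list_decode (l xs)). if P x xs then {} else {0})"
    by (rule computable_list)
  have "f xs = 0 \<longleftrightarrow> (\<forall>x\<in>set (list_decode (l xs)). P x xs)" if "length xs = n" for xs
    using f(2) that list_decode_eq_Nil[of "f xs"] by (auto split: if_splits simp flip: set_empty)
  then show ?thesis
    using decidable_zero[OF f(1)] unfolding decidable_in_def by (auto intro: computable_cong)
qed

section \<open>Codes of grammars\<close>

text \<open>The parity of a code tells nonterminals from terminals. Doubling is written as a sum to
  fall under \<open>computable_add\<close>.\<close>

lemma sym_code_simps: "sym_code \<nu> (NT X) = X + X" "sym_code \<nu> (Tm a) = Suc (\<nu> a + \<nu> a)"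
  by (simp_all add: sum_encode_def)

definition sym_over :: "'t set \<Rightarrow> ('n, 't) sym \<Rightarrow> bool" where
  "sym_over \<Sigma> s \<longleftrightarrow> (\<forall>a. s = Tm a \<longrightarrow> a \<in> \<Sigma>)"

definition syms_code :: "('t \<Rightarrow> nat) \<Rightarrow> (nat, 't) sym list \<Rightarrow> nat" where
  "syms_code \<nu> c = list_encode (map (sym_code \<nu>) c)"

lemma prod_code_eq: "prod_code \<nu> (X, w) = prod_encode (X, syms_code \<nu> w)"
  by (simp add: syms_code_def)

text \<open>Inherited from the injectivity of \<open>cfg_code\<close>, by viewing each rule as a
  grammar with this rule only.\<close>

lemma inj_on_prod_code:
  assumes "inj_on \<nu> \<Sigma>" "rules_over \<Sigma> R"
  shows "inj_on (prod_code \<nu>) R"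
proof (rule inj_onI)
  fix x y assume xy: "x \<in> R" "y \<in> R" "prod_code \<nu> x = prod_code \<nu> y"
  then have "CFG 0 [x] \<in> {g. cfg_over \<Sigma> g}" "CFG 0 [y] \<in> {g. cfg_over \<Sigma> g}"
    using assms(2) by (auto simp: cfg_over_iff rules_over_def)
  moreover have "cfg_code \<nu> (CFG 0 [x]) = cfg_code \<nu> (CFG 0 [y])"
    using xy by (simp add: cfg_code_def)
  ultimately have "CFG 0 [x] = CFG (0 :: nat) [y]" using inj_on_cfg_code[OF assms(1)] by (blast dest: inj_onD)
  then show "x = y" by simp
qed

lemma syms_code_inj:
  assumes "inj_on \<nu> \<Sigma>" "list_all (sym_over \<Sigma>) c" "list_all (sym_over \<Sigma>) d" "syms_code \<nu> c = syms_code \<nu> d"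
  shows "c = d"
proof -
  have "rules_over \<Sigma> {(0 :: nat, c), (0, d)}"
    using assms(2,3) by (auto simp: rules_over_def sym_over_def list_all_iff)
  from inj_onD[OF inj_on_prod_code[OF assms(1) this], of "(0, c)" "(0, d)"] show ?thesis
    using assms(4) by (simp add: syms_code_def)
qed

text \<open>Every number decodes to a grammar, but its terminal letters may lie outside \<open>\<Sigma>\<close>.\<close>

definition valid_sym :: "('t \<Rightarrow> nat) \<Rightarrow> 't set \<Rightarrow> nat \<Rightarrow> bool" where
  "valid_sym \<nu> \<Sigma> k \<longleftrightarrow> k mod 2 = 0 \<or> (\<exists>a\<in>\<Sigma>. k = Suc (\<nu> a + \<nu> a))"

definition valid_code :: "('t \<Rightarrow> nat) \<Rightarrow> 't set \<Rightarrow> nat \<Rightarrow> bool" where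
  "valid_code \<nu> \<Sigma> n \<longleftrightarrow> (\<forall>x\<in>set (list_decode (snd (prod_decode n))).
     \<forall>k\<in>set (list_decode (snd (prod_decode x))). valid_sym \<nu> \<Sigma> k)"

lemma valid_sym_iff: "valid_sym \<nu> \<Sigma> k \<longleftrightarrow> (\<exists>s. sym_over \<Sigma> s \<and> k = sym_code \<nu> s)"
proof
  assume "valid_sym \<nu> \<Sigma> k"
  then consider "k = k div 2 + k div 2" | a where "a \<in> \<Sigma>" "k = Suc (\<nu> a + \<nu> a)"
    unfolding valid_sym_def by fastforce
  then show "\<exists>s. sym_over \<Sigma> s \<and> k = sym_code \<nu> s"
  proof cases
    case 1
    then show ?thesis by (intro exI[of _ "NT (k div 2)"]) (simp add: sym_over_def sym_code_simps del: sym_code.simps)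
  next
    case (2 a)
    then show ?thesis by (intro exI[of _ "Tm a"]) (simp add: sym_over_def sym_code_simps del: sym_code.simps)
  qed
next
  assume "\<exists>s. sym_over \<Sigma> s \<and> k = sym_code \<nu> s"
  then obtain s where s: "sym_over \<Sigma> s" "k = sym_code \<nu> s" by blast
  then show "valid_sym \<nu> \<Sigma> k"
    by (cases s) (auto simp: sym_over_def valid_sym_def sym_code_simps simp del: sym_code.simps)
qed

text \<open>Lifts a description of codes from entries to lists; it is applied to the symbols of a
  rule and to the rules of a grammar.\<close>

lemma list_all_image_iff:
  "(\<forall>k\<in>set ks. \<exists>s. P s \<and> k = f s) \<longleftrightarrow> (\<exists>c. list_all P c \<and> ks = map f c)"
proof
  assume "\<forall>k\<in>set ks. \<exists>s. P s \<and> k = f s"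
  from bchoice[OF this] obtain h where "\<forall>k\<in>set ks. P (h k) \<and> k = f (h k)" ..
  then have "list_all P (map h ks)" "ks = map f (map h ks)"
    by (auto simp: list_all_iff intro!: map_idI[symmetric])
  then show "\<exists>c. list_all P c \<and> ks = map f c" by blast
next
  assume "\<exists>c. list_all P c \<and> ks = map f c"
  then obtain c where "\<forall>s\<in>set c. P s" "set ks = f ` set c" by (auto simp: list_all_iff)
  then show "\<forall>k\<in>set ks. \<exists>s. P s \<and> k = f s" by blast
qed

lemma valid_code_iff: "valid_code \<nu> \<Sigma> n \<longleftrightarrow> (\<exists>g. cfg_over \<Sigma> g \<and> n = cfg_code \<nu> g)"
proof -
  have "(\<forall>k\<in>set (list_decode (snd (prod_decode x))). valid_sym \<nu> \<Sigma> k) \<longleftrightarrow>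
      (\<exists>r. list_all (sym_over \<Sigma>) (snd r) \<and> x = prod_code \<nu> r)" (is "?L \<longleftrightarrow> ?R") for x
  proof
    assume ?L
    then obtain c where c: "list_all (sym_over \<Sigma>) c" "list_decode (snd (prod_decode x)) = map (sym_code \<nu>) c"
      unfolding valid_sym_iff list_all_image_iff by blast
    have "x = prod_encode (fst (prod_decode x), list_encode (list_decode (snd (prod_decode x))))" by simp
    then have "x = prod_code \<nu> (fst (prod_decode x), c)" unfolding c(2) by simp
    then show ?R using c(1) by (intro exI[of _ "(fst (prod_decode x), c)"]) simp
  next
    assume ?R
    then obtain X c where "list_all (sym_over \<Sigma>) c" "x = prod_code \<nu> (X, c)" by auto
    then show ?L by (auto simp: valid_sym_iff list_all_iff)
  qed
  then have *: "valid_code \<nu> \<Sigma> n \<longleftrightarrow>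
      (\<exists>ps. list_all (\<lambda>r. list_all (sym_over \<Sigma>) (snd r)) ps \<and>
        list_decode (snd (prod_decode n)) = map (prod_code \<nu>) ps)"
    unfolding valid_code_def using list_all_image_iff[of "list_decode (snd (prod_decode n))"
      "\<lambda>r. list_all (sym_over \<Sigma>) (snd r)" "prod_code \<nu>"] by (simp only:)
  have over: "cfg_over \<Sigma> g \<longleftrightarrow> list_all (\<lambda>r. list_all (sym_over \<Sigma>) (snd r)) (prods g)"
    for g :: "(nat, 'a) cfg"
    unfolding cfg_over_iff rules_over_def list_all_iff sym_over_def by blast
  show ?thesis
  proof
    assume "valid_code \<nu> \<Sigma> n"
    then obtain ps where ps: "list_all (\<lambda>r. list_all (sym_over \<Sigma>) (snd r)) ps"
      "list_decode (snd (prod_decode n)) = map (prod_code \<nu>) ps" using * by blast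
    have "n = prod_encode (fst (prod_decode n), list_encode (list_decode (snd (prod_decode n))))" by simp
    then have "n = cfg_code \<nu> (CFG (fst (prod_decode n)) ps)" unfolding ps(2) by (simp add: cfg_code_def)
    then show "\<exists>g. cfg_over \<Sigma> g \<and> n = cfg_code \<nu> g" using ps(1) over by fastforce
  next
    assume "\<exists>g. cfg_over \<Sigma> g \<and> n = cfg_code \<nu> g"
    then show "valid_code \<nu> \<Sigma> n" using * over by (auto simp: cfg_code_def)
  qed
qed

lemma decidable_valid_code:
  assumes "finite \<Sigma>"
  shows "decidable_in X 1 (\<lambda>xs. valid_code \<nu> \<Sigma> (xs ! 0))"
proof -
  have s: "decidable_in X n (\<lambda>xs. valid_sym \<nu> \<Sigma> (f xs))" if "computable_in X n f" for n f
    unfolding valid_sym_def using that assms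
    by (intro decidable_disj decidable_zero decidable_bex decidable_eq computable_mod2 computable_const)
  have "decidable_in X n (\<lambda>xs. \<forall>k\<in>set (list_decode (snd (prod_decode (f xs)))). valid_sym \<nu> \<Sigma> k)"
    if "computable_in X n f" for n f
    using that by (intro decidable_ball_list computable_prod_decode s computable_nth) auto
  then show ?thesis
    unfolding valid_code_def
    by (intro decidable_ball_list[where P = "\<lambda>x xs. \<forall>k\<in>set (list_decode (snd (prod_decode x))). valid_sym \<nu> \<Sigma> k"])
      (auto intro: computable_nth computable_prod_decode)
qed

subsection \<open>The transducer construction on codes\<close>

text \<open>The transducer is finite, so its states, edges and letter numbers are constants of the
  programs, and arbitrary injections can serve as numberings.\<close>

locale coded_transducer =
  fixes E :: "('q \<times> 'x option \<times> 'y list \<times> 'q) set" and Q :: "'q set" and \<Sigma> :: "'x set" and \<Delta> :: "'y set"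
    and \<kappa> :: "'q \<Rightarrow> nat" and \<nu> :: "'x \<Rightarrow> nat" and \<nu>' :: "'y \<Rightarrow> nat"
  assumes fin: "finite E" "finite Q" "finite \<Sigma>"
    and inj: "inj_on \<kappa> Q" "inj_on \<nu> \<Sigma>" "inj_on \<nu>' \<Delta>"
    and E: "\<And>p x v r. (p, x, v, r) \<in> E \<Longrightarrow> p \<in> Q \<and> r \<in> Q \<and> set_option x \<subseteq> \<Sigma> \<and> v \<in> lists \<Delta>"
begin

section \<open>The rules of the triple construction as numbers\<close>

definition triple :: "'q \<Rightarrow> nat \<Rightarrow> 'q \<Rightarrow> nat" where
  "triple p c q = prod_encode (\<kappa> p, prod_encode (\<kappa> q, c))"

definition nonterm :: "'q \<times> (nat, 'x) sym list \<times> 'q \<Rightarrow> nat" where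
  "nonterm = (\<lambda>(p, c, q). triple p (syms_code \<nu> c) q)"

definition rule_code :: "('q \<times> (nat, 'x) sym list \<times> 'q) \<times> ('q \<times> (nat, 'x) sym list \<times> 'q, 'y) sym list \<Rightarrow> nat" where
  "rule_code x = prod_code \<nu>' (rename nonterm x)"

text \<open>The rule of an edge from \<open>p\<close> to \<open>r\<close> with output
  \<open>v\<close>, computed from suffix codes: \<open>d\<close> is \<open>c\<close> itself if the
  edge reads nothing and the tail of \<open>c\<close> if it reads the head.\<close>

definition output_rule :: "'q \<Rightarrow> nat \<Rightarrow> 'q \<Rightarrow> 'y list \<Rightarrow> 'q \<Rightarrow> nat \<Rightarrow> nat" where
  "output_rule p c q v r d = prod_encode (triple p c q,
     foldr (\<lambda>a. code_cons (Suc (\<nu>' a + \<nu>' a))) v (code_cons (triple r d q + triple r d q) 0))"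

lemma rule_code_output:
  "rule_code ((p, c, q), map Tm v @ [NT (r, d, q)]) = output_rule p (syms_code \<nu> c) q v r (syms_code \<nu> d)"
proof -
  have "foldr (\<lambda>a. code_cons (Suc (\<nu>' a + \<nu>' a))) v (list_encode xs) =
      list_encode (map (\<lambda>a. Suc (\<nu>' a + \<nu>' a)) v @ xs)" for xs
    by (induction v) (simp_all add: list_encode_Cons del: list_encode.simps)
  moreover have "code_cons x 0 = list_encode [x]" for x by (simp add: code_cons_def)
  ultimately show ?thesis
    by (simp add: rule_code_def output_rule_def nonterm_def syms_code_def sym_code_simps comp_def
        del: sym_code.simps list_encode.simps)
qed

definition local_codes :: "nat \<Rightarrow> nat set" where
  "local_codes c = (if c = 0 then {}
     else if code_hd c mod 2 = 0 then
       (\<Union>p\<in>Q. \<Union>r\<in>Q. \<Union>q\<in>Q. {prod_encode (triple p c q,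
          code_cons (triple p (code_cons (code_hd c) 0) r + triple p (code_cons (code_hd c) 0) r)
            (code_cons (triple r (code_tl c) q + triple r (code_tl c) q) 0))})
     else (\<Union>e\<in>E. \<Union>q\<in>Q. case e of (p, x, v, r) \<Rightarrow> (case x of None \<Rightarrow> {} | Some a \<Rightarrow>
       if code_hd c = Suc (\<nu> a + \<nu> a) then {output_rule p c q v r (code_tl c)} else {})))"

definition eps_codes :: "nat \<Rightarrow> nat set" where
  "eps_codes c = (\<Union>e\<in>E. \<Union>q\<in>Q. case e of (p, x, v, r) \<Rightarrow>
     (case x of None \<Rightarrow> {output_rule p c q v r c} | Some a \<Rightarrow> {}))"

definition trans_codes :: "nat \<Rightarrow> nat set" where
  "trans_codes n =
     (\<Union>p\<in>Q. {prod_encode (triple p 0 p, 0)}) \<union>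
     (\<Union>x\<in>set (list_decode (snd (prod_decode n))).
       (\<Union>p\<in>Q. \<Union>q\<in>Q. {prod_encode
         (triple p (code_cons (fst (prod_decode x) + fst (prod_decode x)) 0) q,
          code_cons (triple p (snd (prod_decode x)) q + triple p (snd (prod_decode x)) q) 0)}) \<union>
       (\<Union>j. eps_codes (code_drop j (snd (prod_decode x))) \<union> local_codes (code_drop j (snd (prod_decode x)))))"

lemma syms_code_simps:
  "syms_code \<nu> [] = 0" "syms_code \<nu> (s # c) = code_cons (sym_code \<nu> s) (syms_code \<nu> c)"
  by (simp_all add: syms_code_def code_cons_def)

lemma code_cons_nonzero [simp]: "code_cons x c \<noteq> 0" "0 < code_cons x c"
  by (simp_all add: code_cons_def)

text \<open>The program compares numbers where the rules compare letters. The two tests agree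
  because the letters of \<open>c\<close> and of the edges lie in \<open>\<Sigma>\<close>, where
  \<open>\<nu>\<close> is injective.\<close>

lemma local_codes_eq:
  assumes "list_all (sym_over \<Sigma>) c"
  shows "local_codes (syms_code \<nu> c) = rule_code ` local_rules E Q c"
proof (cases "(E, Q, c)" rule: local_rules.cases)
  case 1
  then have "c = []" by simp
  then show ?thesis by (simp add: syms_code_simps local_codes_def)
next
  case (2 E' Q' X d)
  have c: "c = NT X # d" using 2 by simp
  have r: "rule_code ((p, c, q), [NT (p, [NT X], r), NT (r, d, q)]) = prod_encode (triple p (syms_code \<nu> c) q,
      code_cons (triple p (code_cons (X + X) 0) r + triple p (code_cons (X + X) 0) r)
        (code_cons (triple r (syms_code \<nu> d) q + triple r (syms_code \<nu> d) q) 0))" for p q r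
    by (simp add: rule_code_def nonterm_def prod_code_eq syms_code_def list_encode_Cons sym_code_simps
        del: sym_code.simps list_encode.simps(2) prod_code.simps)
  show ?thesis
    by (simp add: c local_codes_def r[unfolded c] image_UN syms_code_simps sym_code_simps del: sym_code.simps)
next
  case (3 E' Q' a d)
  have c: "c = Tm a # d" using 3 by simp
  have a: "a \<in> \<Sigma>" using assms c by (simp add: sym_over_def)
  have eq: "(case e of (p, x, v, r) \<Rightarrow> (case x of None \<Rightarrow> {} | Some b \<Rightarrow>
       if Suc (\<nu> a + \<nu> a) = Suc (\<nu> b + \<nu> b) then {output_rule p (syms_code \<nu> c) q v r (syms_code \<nu> d)} else {})) =
     rule_code ` (case e of (p, x, v, r) \<Rightarrow>
       if x = Some a then {((p, Tm a # d, q), map Tm v @ [NT (r, d, q)])} else {})"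
    if "e \<in> E" for e q
  proof -
    obtain p x v r where e: "e = (p, x, v, r)" by (cases e)
    show ?thesis
    proof (cases x)
      case (Some b)
      then have "b \<in> \<Sigma>" using E that e by fastforce
      then have "\<nu> a + \<nu> a = \<nu> b + \<nu> b \<longleftrightarrow> a = b" using inj_onD[OF inj(2) _ a] by auto
      then show ?thesis using Some e by (auto simp: rule_code_output c)
    qed (simp add: e)
  qed
  have "local_codes (syms_code \<nu> c) = (\<Union>e\<in>E. \<Union>q\<in>Q. case e of (p, x, v, r) \<Rightarrow> (case x of None \<Rightarrow> {} | Some b \<Rightarrow>
       if Suc (\<nu> a + \<nu> a) = Suc (\<nu> b + \<nu> b) then {output_rule p (syms_code \<nu> c) q v r (syms_code \<nu> d)} else {}))"
  proof -
    have nz: "syms_code \<nu> c \<noteq> 0"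
      and hd: "code_hd (syms_code \<nu> c) = Suc (\<nu> a + \<nu> a)"
      and tl: "code_tl (syms_code \<nu> c) = syms_code \<nu> d"
      by (simp_all add: c syms_code_simps sym_code_simps del: sym_code.simps)
    have odd: "Suc (\<nu> a + \<nu> a) mod 2 \<noteq> 0" by presburger
    show ?thesis unfolding local_codes_def hd tl if_not_P[OF nz] if_not_P[OF odd] ..
  qed
  also have "\<dots> = (\<Union>e\<in>E. \<Union>q\<in>Q. rule_code ` (case e of (p, x, v, r) \<Rightarrow>
       if x = Some a then {((p, Tm a # d, q), map Tm v @ [NT (r, d, q)])} else {}))"
    using eq by (intro SUP_cong refl) blast
  also have "\<dots> = rule_code ` local_rules E Q c"
    by (simp only: c local_rules.simps image_UN split_beta)
  finally show ?thesis .
qed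

lemma eps_codes_eq: "eps_codes (syms_code \<nu> c) = rule_code ` eps_rules E Q c"
proof -
  have eq: "(case e of (p, x, v, r) \<Rightarrow>
      (case x of None \<Rightarrow> {output_rule p (syms_code \<nu> c) q v r (syms_code \<nu> c)} | Some a \<Rightarrow> {})) =
     rule_code ` (case e of (p, x, v, r) \<Rightarrow>
       if x = None then {((p, c, q), map Tm v @ [NT (r, c, q)])} else {})" for e q
    by (cases e; cases "fst (snd e)") (auto simp: rule_code_output)
  show ?thesis unfolding eps_codes_def eps_rules_def eq by (simp only: image_UN split_beta)
qed

lemma suffs_over: "rules_over \<Sigma> R \<Longrightarrow> c \<in> suffs R \<Longrightarrow> list_all (sym_over \<Sigma>) c"
  unfolding suffs_def rules_over_def sym_over_def list_all_iff by fastforce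

lemma trans_codes_eq:
  assumes g: "cfg_over \<Sigma> g"
  shows "trans_codes (cfg_code \<nu> g) = rule_code ` trans_rules E Q (set (prods g))"
proof -
  let ?R = "set (prods g)"
  have R: "set (list_decode (snd (prod_decode (cfg_code \<nu> g)))) = prod_code \<nu> ` ?R"
    by (simp add: cfg_code_def)
  \<comment> \<open>Dropping commutes with coding, so the union over all \<open>j\<close> runs
    exactly through the codes of the suffixes of \<open>c\<close>.\<close>
  have "code_drop j (syms_code \<nu> c) = syms_code \<nu> (drop j c)" for j c
    by (simp add: code_drop syms_code_def drop_map)
  then have "(\<Union>j. eps_codes (code_drop j (syms_code \<nu> c)) \<union> local_codes (code_drop j (syms_code \<nu> c))) =
      (\<Union>d\<in>(\<lambda>j. drop j c) ` UNIV. eps_codes (syms_code \<nu> d) \<union> local_codes (syms_code \<nu> d))" for c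
    by auto
  then have "(\<Union>(X, c)\<in>?R. \<Union>j. eps_codes (code_drop j (syms_code \<nu> c)) \<union> local_codes (code_drop j (syms_code \<nu> c))) =
      (\<Union>c\<in>suffs ?R. eps_codes (syms_code \<nu> c) \<union> local_codes (syms_code \<nu> c))"
    unfolding suffs_eq by (auto simp: split_beta)
  also have "\<dots> = rule_code ` (\<Union>c\<in>suffs ?R. eps_rules E Q c \<union> local_rules E Q c)"
    using suffs_over[of ?R] g unfolding cfg_over_iff
    by (simp add: image_UN image_Un eps_codes_eq local_codes_eq)
  finally have 1: "(\<Union>(X, c)\<in>?R. \<Union>j. eps_codes (code_drop j (syms_code \<nu> c)) \<union>
      local_codes (code_drop j (syms_code \<nu> c))) =
    rule_code ` (\<Union>c\<in>suffs ?R. eps_rules E Q c \<union> local_rules E Q c)" .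
  have 2: "rule_code ((p, [NT X], q), [NT (p, c, q)]) =
      prod_encode (triple p (code_cons (X + X) 0) q,
        code_cons (triple p (syms_code \<nu> c) q + triple p (syms_code \<nu> c) q) 0)" for p q X c
    by (simp add: rule_code_def nonterm_def prod_code_eq syms_code_def list_encode_Cons sym_code_simps
        del: sym_code.simps list_encode.simps(2) prod_code.simps)
  have 3: "rule_code ((p, [], p), []) = prod_encode (triple p 0 p, 0)" for p
    by (simp add: rule_code_def nonterm_def syms_code_def)
  define L where "L c = (\<Union>j. eps_codes (code_drop j c) \<union> local_codes (code_drop j c))" for c
  define M where "M X c = (\<Union>p\<in>Q. \<Union>q\<in>Q. {prod_encode (triple p (code_cons (X + X) 0) q,
    code_cons (triple p c q + triple p c q) 0)})" for X c
  have "trans_codes (cfg_code \<nu> g) = (\<Union>p\<in>Q. {prod_encode (triple p 0 p, 0)}) \<union>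
      (\<Union>x\<in>prod_code \<nu> ` ?R. M (fst (prod_decode x)) (snd (prod_decode x)) \<union> L (snd (prod_decode x)))"
    unfolding trans_codes_def R M_def L_def ..
  also have "(\<Union>x\<in>prod_code \<nu> ` ?R. M (fst (prod_decode x)) (snd (prod_decode x)) \<union> L (snd (prod_decode x))) =
      (\<Union>(X, c)\<in>?R. M X (syms_code \<nu> c) \<union> L (syms_code \<nu> c))"
    unfolding image_image by (intro SUP_cong refl) (auto simp: prod_code_eq simp del: prod_code.simps)
  also have "\<dots> = (\<Union>(X, c)\<in>?R. M X (syms_code \<nu> c)) \<union> (\<Union>(X, c)\<in>?R. L (syms_code \<nu> c))"
    by (simp add: split_beta UN_Un_distrib)
  finally have "trans_codes (cfg_code \<nu> g) =
     (\<Union>p\<in>Q. {rule_code ((p, [], p), [])}) \<union>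
     ((\<Union>(X, c)\<in>?R. \<Union>p\<in>Q. \<Union>q\<in>Q. {rule_code ((p, [NT X], q), [NT (p, c, q)])}) \<union>
      (\<Union>(X, c)\<in>?R. \<Union>j. eps_codes (code_drop j (syms_code \<nu> c)) \<union> local_codes (code_drop j (syms_code \<nu> c))))"
    unfolding M_def L_def 2 3 .
  then show ?thesis
    unfolding 1 trans_rules_def by (simp add: image_Un image_UN split_beta Un_assoc)
qed

section \<open>Programs that list the rules of the new grammar\<close>

lemma computable_triple:
  "computable_in X n f \<Longrightarrow> computable_in X n (\<lambda>xs. triple p (f xs) q)"
  unfolding triple_def by (intro computable_prod_encode computable_const)

lemma computable_output_rule:
  assumes "computable_in X n f" "computable_in X n g"
  shows "computable_in X n (\<lambda>xs. output_rule p (f xs) q v r (g xs))"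
proof -
  have h: "computable_in X n (\<lambda>xs. code_cons (triple r (g xs) q + triple r (g xs) q) 0)"
    by (intro computable_cons computable_add computable_triple assms computable_const)
  have "computable_in X n (\<lambda>xs. foldr (\<lambda>a. code_cons (Suc (\<nu>' a + \<nu>' a))) v
      (code_cons (triple r (g xs) q + triple r (g xs) q) 0))"
  proof (induction v)
    case (Cons a v)
    then show ?case using computable_cons[OF computable_const Cons] by simp
  qed (simp add: h)
  then show ?thesis
    unfolding output_rule_def by (intro computable_prod_encode computable_triple assms)
qed

lemma emits_local_codes:
  assumes "computable_in X n f"
  shows "emits X n (\<lambda>xs. local_codes (f xs))"
proof -
  have "emits X n (\<lambda>xs. case e of (p, x, v, r) \<Rightarrow> (case x of None \<Rightarrow> {} | Some a \<Rightarrow>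
      if code_hd (f xs) = Suc (\<nu> a + \<nu> a) then {output_rule p (f xs) q v r (code_tl (f xs))} else {}))" for e q
  proof -
    obtain p x v r where e: "e = (p, x, v, r)" by (cases e)
    show ?thesis
    proof (cases x)
      case (Some a)
      have "emits X n (\<lambda>xs. if code_hd (f xs) = Suc (\<nu> a + \<nu> a)
          then {output_rule p (f xs) q v r (code_tl (f xs))} else {})"
        by (intro emits_if decidable_eq emits_insert emits_empty computable_output_rule assms
            computable_tl computable_hd computable_const)
      then show ?thesis by (simp add: e Some)
    qed (simp add: e emits_empty)
  qed
  then show ?thesis
    unfolding local_codes_def using assms fin
    by (intro emits_if decidable_zero emits_UN_finite emits_insert emits_empty computable_prod_encode
        computable_mod2 computable_hd computable_tl computable_triple computable_cons computable_add
        computable_const)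
qed

lemma emits_eps_codes:
  assumes "computable_in X n f"
  shows "emits X n (\<lambda>xs. eps_codes (f xs))"
proof -
  have "emits X n (\<lambda>xs. case e of (p, x, v, r) \<Rightarrow>
      (case x of None \<Rightarrow> {output_rule p (f xs) q v r (f xs)} | Some a \<Rightarrow> {}))" for e q
  proof -
    obtain p x v r where e: "e = (p, x, v, r)" by (cases e)
    have "emits X n (\<lambda>xs. {output_rule p (f xs) q v r (f xs)})"
      by (intro emits_insert computable_output_rule assms)
    then show ?thesis by (cases x) (simp_all add: e emits_empty)
  qed
  then show ?thesis unfolding eps_codes_def using fin by (intro emits_UN_finite)
qed

lemma emits_trans_codes: "emits X 1 (\<lambda>xs. trans_codes (xs ! 0))"
proof -
  define S where "S = (\<lambda>x (xs :: nat list). (\<Union>p\<in>Q. \<Union>q\<in>Q. {prod_encode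
         (triple p (code_cons (fst (prod_decode x) + fst (prod_decode x)) 0) q,
          code_cons (triple p (snd (prod_decode x)) q + triple p (snd (prod_decode x)) q) 0)}) \<union>
       (\<Union>j. eps_codes (code_drop j (snd (prod_decode x))) \<union> local_codes (code_drop j (snd (prod_decode x)))))"
  have "emits X 2 (\<lambda>xs. \<Union>j. (\<lambda>c xs. eps_codes c \<union> local_codes c) (code_drop j (snd (prod_decode (xs ! 0)))) xs)"
  proof (rule emits_UN_suffixes)
    show "computable_in X 2 (\<lambda>xs. snd (prod_decode (xs ! 0)))"
      by (intro computable_prod_decode computable_nth) simp
    have "emits X (Suc 2) (\<lambda>xs. eps_codes (xs ! 0))" "emits X (Suc 2) (\<lambda>xs. local_codes (xs ! 0))"
      by (intro emits_eps_codes emits_local_codes computable_nth; simp)+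
    then show "emits X (Suc 2) (\<lambda>xs. eps_codes (xs ! 0) \<union> local_codes (xs ! 0))" by (rule emits_Un)
  qed
  then have suffixes: "emits X (Suc 1) (\<lambda>xs. \<Union>j. eps_codes (code_drop j (snd (prod_decode (xs ! 0)))) \<union>
      local_codes (code_drop j (snd (prod_decode (xs ! 0)))))" by (simp add: numeral_2_eq_2)
  have "emits X (Suc 1) (\<lambda>xs. S (xs ! 0) (drop 1 xs))"
    unfolding S_def using fin
    by (intro emits_Un[OF _ suffixes] emits_UN_finite emits_insert computable_prod_encode computable_triple
      computable_cons computable_add computable_const computable_prod_decode computable_nth) auto
  then have "emits X 1 (\<lambda>xs. \<Union>x\<in>set (list_decode (snd (prod_decode (xs ! 0)))). S x xs)"
    by (intro emits_UN_list computable_prod_decode computable_nth) auto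
  then have "emits X 1 (\<lambda>xs. (\<Union>p\<in>Q. {prod_encode (triple p 0 p, 0)}) \<union>
      (\<Union>x\<in>set (list_decode (snd (prod_decode (xs ! 0)))). S x xs))"
    using fin by (intro emits_Un emits_UN_finite emits_insert computable_const)
  then show ?thesis unfolding trans_codes_def S_def .
qed

text \<open>The triples on which \<open>nonterm\<close> is known to be injective, as
  \<open>\<kappa>\<close> and \<open>\<nu>\<close> are injective on \<open>Q\<close> and
  \<open>\<Sigma>\<close> only. All nonterminals of the new grammar are of this kind.\<close>

definition proper :: "('q \<times> (nat, 'x) sym list \<times> 'q) set" where
  "proper = Q \<times> {c. list_all (sym_over \<Sigma>) c} \<times> Q"

lemma inj_on_nonterm: "inj_on nonterm proper"
  unfolding inj_on_def proper_def nonterm_def triple_def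
  by (auto simp: prod_encode_eq dest: inj_onD[OF inj(1)] syms_code_inj[OF inj(2)])

lemma nonterms_trans_rules:
  assumes R: "rules_over \<Sigma> R"
  shows "nonterms (trans_rules E Q R) \<subseteq> proper"
proof -
  have E': "p \<in> Q" "r \<in> Q" if "(p, x, v, r) \<in> E" for p x v r using that E by blast+
  have R': "list_all (sym_over \<Sigma>) c" if "(X, c) \<in> R" for X c
    using suffs_over[OF R suffs_intro[OF that]] .
  have NT: "sym_over \<Sigma> (NT X)" for X :: nat by (simp add: sym_over_def)
  have "Y \<in> proper \<and> (\<forall>Z. NT Z \<in> set s \<longrightarrow> Z \<in> proper)" if Y: "(Y, s) \<in> trans_rules E Q R" for Y s
  proof -
    from Y consider p where "p \<in> Q" "Y = (p, [], p)" "s = []"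
      | X c p q where "(X, c) \<in> R" "p \<in> Q" "q \<in> Q" "Y = (p, [NT X], q)" "s = [NT (p, c, q)]"
      | c where "c \<in> suffs R" "(Y, s) \<in> eps_rules E Q c" | c where "c \<in> suffs R" "(Y, s) \<in> local_rules E Q c"
      unfolding trans_rules_def by blast
    then show ?thesis
    proof cases
      case 1
      then show ?thesis by (simp add: proper_def)
    next
      case 2
      then show ?thesis using R' NT by (simp add: proper_def)
    next
      case (3 c)
      have "list_all (sym_over \<Sigma>) c" using suffs_over[OF R 3(1)] .
      then show ?thesis using 3(2) E' by (auto simp: eps_rules_def proper_def split: if_splits)
    next
      case (4 c)
      have c: "list_all (sym_over \<Sigma>) c" using suffs_over[OF R 4(1)] .
      show ?thesis
        by (cases "(E, Q, c)" rule: local_rules.cases)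
          (use 4(2) c E' NT in \<open>auto simp: proper_def split: if_splits\<close>)
    qed
  qed
  then show ?thesis unfolding nonterms_def by fast
qed

section \<open>From transductions of grammars to Turing reductions\<close>

theorem computable_transduction:
  assumes Q: "p \<in> Q" "q \<in> Q"
  shows "\<exists>f. computable_in X 1 f \<and> (\<forall>g. cfg_over \<Sigma> g \<longrightarrow> (\<exists>g'. cfg_over \<Delta> g' \<and>
    f [cfg_code \<nu> g] = cfg_code \<nu>' g' \<and> lang g' = {u. \<exists>w\<in>lang g. path E p w u q}))"
proof -
  obtain F where F: "computable_in X 1 F"
    "\<forall>xs. length xs = 1 \<longrightarrow> set (list_decode (F xs)) = trans_codes (xs ! 0)"
    using emits_trans_codes by (rule computable_list)
  \<comment> \<open>The first component is the code of the triple
    \<open>(p, [NT (start g)], q)\<close>, the start symbol of the new grammar.\<close>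
  define f where "f xs = prod_encode
    (triple p (code_cons (fst (prod_decode (xs ! 0)) + fst (prod_decode (xs ! 0))) 0) q, F xs)" for xs
  have "computable_in X 1 f"
    unfolding f_def using F(1)
    by (intro computable_prod_encode computable_triple computable_cons computable_add computable_const
        computable_prod_decode computable_nth) auto
  moreover have "\<exists>g'. cfg_over \<Delta> g' \<and> f [cfg_code \<nu> g] = cfg_code \<nu>' g' \<and>
    lang g' = {u. \<exists>w\<in>lang g. path E p w u q}" if g: "cfg_over \<Sigma> g" for g
  proof -
    let ?R = "trans_rules E Q (set (prods g))" and ?S = "(p, [NT (start g)], q)"
    let ?T = "rename nonterm ` ?R"
    have R: "rules_over \<Delta> ?R" using E by (intro trans_rules_over) blast
    then have inj_T: "inj_on (prod_code \<nu>') ?T"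
      by (intro inj_on_prod_code[OF inj(3)]) (simp add: rules_over_rename)
    have set_F: "set (list_decode (F [cfg_code \<nu> g])) = prod_code \<nu>' ` ?T"
      using F(2) trans_codes_eq[OF g] by (simp add: rule_code_def image_image)
    \<comment> \<open>Only the set of entries of the computed list is known. Decoding it entry by
      entry gives a grammar whose code is exactly the computed number, in whatever order and with
      whatever repetitions the rules were emitted.\<close>
    define ps where "ps = map (inv_into ?T (prod_code \<nu>')) (list_decode (F [cfg_code \<nu> g]))"
    have "set ps = ?T" unfolding ps_def using set_F inv_into_image_cancel[OF inj_T order_refl] by simp
    moreover have "map (prod_code \<nu>') ps = list_decode (F [cfg_code \<nu> g])"
      unfolding ps_def by (simp add: map_idI f_inv_into_f set_F[symmetric])
    moreover define g' where "g' = CFG (nonterm ?S) ps"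
    ultimately have g': "prods g' = ps" "set ps = ?T" "map (prod_code \<nu>') ps = list_decode (F [cfg_code \<nu> g])"
      "start g' = nonterm ?S" by simp_all
    have "cfg_over \<Delta> g'" using R g' by (simp add: cfg_over_iff rules_over_rename)
    moreover have "f [cfg_code \<nu> g] = cfg_code \<nu>' g'"
      by (simp add: cfg_code_def g' f_def nonterm_def syms_code_simps sym_code_simps del: sym_code.simps)
    moreover have "?S \<in> proper" using Q by (simp add: proper_def sym_over_def)
    then have "lang g' = {u. yields ?R [NT ?S] u}"
      unfolding lang_eq_yields g'
      using yields_rename_iff[OF inj_on_nonterm _ nonterms_trans_rules, of ?S "set (prods g)"] g
      by (auto simp: cfg_over_iff)
    then have "lang g' = {u. \<exists>w\<in>lang g. path E p w u q}"
      using yields_trans_rules_iff[OF _ Q, of E "set (prods g)" "start g"] E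
      unfolding lang_eq_yields by auto
    ultimately show ?thesis by blast
  qed
  ultimately show ?thesis by blast
qed

text \<open>One query for each end state in \<open>F\<close>, all of which must succeed. The test
  \<open>valid_code\<close> comes along because on a number that codes no instance the computed
  values are arbitrary and might all code positive instances.\<close>

theorem turing_reducible_transductions:
  assumes p: "p \<in> Q" and F: "F \<subseteq> Q"
    and iff: "\<And>g :: (nat, 'x) cfg. cfg_over \<Sigma> g \<Longrightarrow>
      \<phi> (lang g) \<longleftrightarrow> (\<forall>q\<in>F. \<psi> {u. \<exists>w\<in>lang g. path E p w u q})"
  shows "{cfg_code \<nu> g | g. cfg_over \<Sigma> g \<and> \<phi> (lang g)} \<le>\<^sub>T {cfg_code \<nu>' g | g. cfg_over \<Delta> g \<and> \<psi> (lang g)}"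
    (is "?P \<le>\<^sub>T ?X")
proof (rule turing_reducible_if_decidable)
  have "\<forall>q\<in>F. \<exists>f. computable_in ?X 1 f \<and> (\<forall>g. cfg_over \<Sigma> g \<longrightarrow> (\<exists>g'. cfg_over \<Delta> g' \<and>
    f [cfg_code \<nu> g] = cfg_code \<nu>' g' \<and> lang g' = {u. \<exists>w\<in>lang g. path E p w u q}))"
  proof
    fix q assume "q \<in> F"
    then have "q \<in> Q" using F by blast
    from computable_transduction[OF p this]
    show "\<exists>f. computable_in ?X 1 f \<and> (\<forall>g. cfg_over \<Sigma> g \<longrightarrow> (\<exists>g'. cfg_over \<Delta> g' \<and>
      f [cfg_code \<nu> g] = cfg_code \<nu>' g' \<and> lang g' = {u. \<exists>w\<in>lang g. path E p w u q}))" .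
  qed
  from bchoice[OF this] obtain f where f_ex: "\<forall>q\<in>F. computable_in ?X 1 (f q) \<and>
      (\<forall>g. cfg_over \<Sigma> g \<longrightarrow> (\<exists>g'. cfg_over \<Delta> g' \<and>
        f q [cfg_code \<nu> g] = cfg_code \<nu>' g' \<and> lang g' = {u. \<exists>w\<in>lang g. path E p w u q}))" ..
  have f: "computable_in ?X 1 (f q)"
    "cfg_over \<Sigma> g \<Longrightarrow> \<exists>g'. cfg_over \<Delta> g' \<and>
      f q [cfg_code \<nu> g] = cfg_code \<nu>' g' \<and> lang g' = {u. \<exists>w\<in>lang g. path E p w u q}"
    if "q \<in> F" for q g
    using bspec[OF f_ex that] by (elim conjE; simp)+
  have f_iff: "f q [cfg_code \<nu> g] \<in> ?X \<longleftrightarrow> \<psi> {u. \<exists>w\<in>lang g. path E p w u q}"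
    if q: "q \<in> F" and g: "cfg_over \<Sigma> g" for q g
  proof -
    obtain g' where g': "cfg_over \<Delta> g'" "f q [cfg_code \<nu> g] = cfg_code \<nu>' g'"
      "lang g' = {u. \<exists>w\<in>lang g. path E p w u q}" using f(2)[OF q g] by blast
    \<comment> \<open>The oracle set mentions some grammar with the queried code; by injectivity of
      the coding over \<open>\<Delta>\<close> that grammar is \<open>g'\<close>.\<close>
    have "cfg_code \<nu>' g' \<in> ?X \<longleftrightarrow> \<psi> (lang g')"
      using inj_onD[OF inj_on_cfg_code[OF inj(3)]] g'(1) by fastforce
    then show ?thesis using g' by simp
  qed
  have P_iff: "n \<in> ?P \<longleftrightarrow> valid_code \<nu> \<Sigma> n \<and> (\<forall>q\<in>F. f q [n] \<in> ?X)" for n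
  proof
    assume "n \<in> ?P"
    then obtain g where g: "n = cfg_code \<nu> g" "cfg_over \<Sigma> g" "\<phi> (lang g)" by blast
    then show "valid_code \<nu> \<Sigma> n \<and> (\<forall>q\<in>F. f q [n] \<in> ?X)"
      using f_iff iff by (auto simp: valid_code_iff)
  next
    assume n: "valid_code \<nu> \<Sigma> n \<and> (\<forall>q\<in>F. f q [n] \<in> ?X)"
    then obtain g where g: "n = cfg_code \<nu> g" "cfg_over \<Sigma> g" using valid_code_iff by blast
    then have "\<phi> (lang g)" using n f_iff iff by blast
    then show "n \<in> ?P" using g by blast
  qed
  have "finite F" using F fin finite_subset by blast
  then have "decidable_in ?X 1 (\<lambda>xs. valid_code \<nu> \<Sigma> (xs ! 0) \<and> (\<forall>q\<in>F. f q xs \<in> ?X))"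
    using f(1) fin
    by (intro decidable_conj decidable_valid_code decidable_ball decidable_query)
  moreover have "xs ! 0 \<in> ?P \<longleftrightarrow> valid_code \<nu> \<Sigma> (xs ! 0) \<and> (\<forall>q\<in>F. f q xs \<in> ?X)"
    if "length xs = 1" for xs
  proof -
    have "xs = [xs ! 0]" using that by (cases xs) auto
    then show ?thesis using P_iff[of "xs ! 0"] by simp
  qed
  ultimately show "decidable_in ?X 1 (\<lambda>xs. xs ! 0 \<in> ?P)"
    unfolding decidable_in_def by (elim computable_cong) simp
qed

end

theorem proposition3p13:
  fixes G :: "('a, 'm) monoid_scheme"
    and A B H :: "'a set"
    and \<nu>\<^sub>1 \<nu>\<^sub>2 :: "'a letter \<Rightarrow> nat"
  assumes "group G"
    and "finite A" and "A \<subseteq> carrier G" and "generate G A = carrier G"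
    and "subgroup H G" and "finite (rcosets\<^bsub>G\<^esub> H)"
    and "finite B" and "B \<subseteq> H" and "generate G B = H"
    and "inj_on \<nu>\<^sub>1 (tilde A)" and "inj_on \<nu>\<^sub>2 (tilde B)"
  shows "recursively_equivalent
           (CF_problem \<nu>\<^sub>1 G A)
           (CF_problem \<nu>\<^sub>2 (G\<lparr>carrier := H\<rparr>) B)"
proof -
  interpret finite_index_subgroup G A B H
    using assms by (simp add: finite_index_subgroup_def finite_index_subgroup_axioms_def)
  let ?E = "machine_edges move rewrite (rcosets\<^bsub>G\<^esub> H) (tilde A)"
  obtain \<kappa> :: "'a set \<Rightarrow> nat" where \<kappa>: "inj_on \<kappa> (rcosets\<^bsub>G\<^esub> H)"
    using finite_imp_inj_to_nat_seg[OF assms(6)] by auto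
  have "?E = (\<lambda>(p, a). (p, Some a, rewrite p a, move p a)) ` ((rcosets\<^bsub>G\<^esub> H) \<times> tilde A)"
    by (auto simp: machine_edges_def)
  then have "finite ?E" using finite_tilde fin by simp
  \<comment> \<open>The states are the cosets, each of which will be an end state: one query per
    coset, starting from \<open>H\<close>.\<close>
  then interpret R: coded_transducer ?E "rcosets\<^bsub>G\<^esub> H" "tilde A" "tilde B" \<kappa> \<nu>\<^sub>1 \<nu>\<^sub>2
    using finite_tilde fin assms(10,11) \<kappa> move_in rewrite_spec(1)[unfolded in_lists_conv_set]
    by unfold_locales (auto simp: machine_edges_def)
  have "CF_problem \<nu>\<^sub>1 G A \<le>\<^sub>T CF_problem \<nu>\<^sub>2 GH B"
    unfolding CF_problem_def
    by (rule R.turing_reducible_transductions[where \<phi> = "\<lambda>L. word_val G ` L \<in> CF G A"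
        and \<psi> = "\<lambda>L. word_val GH ` L \<in> CF GH B", OF H_coset order_refl CF_iff_rewritten[OF lang_over]])
  let ?E' = "machine_edges stay subst UNIV (tilde B)"
  have "?E' = (\<lambda>a. ((), Some a, subst () a, ())) ` tilde B"
    by (auto simp: machine_edges_def)
  then have "finite ?E'" using finite_tilde by simp
  \<comment> \<open>With a single state the constant numbering is injective, and the reduction makes
    a single query.\<close>
  then interpret S: coded_transducer ?E' UNIV "tilde B" "tilde A" "\<lambda>_. 0" \<nu>\<^sub>2 \<nu>\<^sub>1
    using finite_tilde assms(10,11) subst_spec(1)[unfolded in_lists_conv_set]
    by unfold_locales (auto simp: machine_edges_def inj_on_def[of "\<lambda>_ :: unit. 0"])
  have "CF_problem \<nu>\<^sub>2 GH B \<le>\<^sub>T CF_problem \<nu>\<^sub>1 G A"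
    unfolding CF_problem_def
    by (rule S.turing_reducible_transductions[where \<phi> = "\<lambda>L. word_val GH ` L \<in> CF GH B"
        and \<psi> = "\<lambda>L. word_val G ` L \<in> CF G A" and p = "()" and F = "{()}"])
      (simp_all add: CF_iff_substituted[OF lang_over])
  with \<open>CF_problem \<nu>\<^sub>1 G A \<le>\<^sub>T CF_problem \<nu>\<^sub>2 GH B\<close> show ?thesis
    unfolding recursively_equivalent_def by blast
qed

end
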